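(* Let $d\ge 1$ be an integer, let $0<\alpha<\beta<1/2$, $\sigma>0$, $\zeta\in\mathbb{R}$, and let $G_n=G_n(\alpha,\beta,\sigma,\zeta)$ be the modified Newman-Watts random graph on the $d$-dimensional lattice torus $T_n^d$. Let ${\rm diam}(G_n)$ denote its graph diameter. A. Suppose that $\Gamma:=(2\beta)^d-(2\alpha)^d>1/2$. Then: (i) if $0<\zeta<1$ and $\sigma>0$, or if $\zeta=0$ and $\sigma$ is large enough (i.e. $\sigma\ge\sigma_0$ for some $\sigma_0=\sigma_0(d,\alpha,\beta)$), there exists a constant $C_1>0$ (not depending on $n$) such that $$\lim_{n\to\infty}\mathbb{P}\big({\rm diam}(G_n)\le C_1\ln^3 n\big)=1;$$ (ii) if $\zeta>1$ and $\sigma>0$, or if $\zeta=1$ and $\sigma$ is large enough (i.e. $\sigma\ge\sigma_1$ for some $\sigma_1=\sigma_1(d,\alpha,\beta)$), there exists a constant $C_2>0$ (not depending on $n$) such that $$\lim_{n\to\infty}\mathbb{P}\big({\rm diam}(G_n)\le C_2\ln^2 n\big)=1.$$ B. Suppose $\sigma>0$, $\zeta<1$ and $0<\alpha<\beta<1/2$ (no condition on $\Gamma$). Then for every $0<\nu<(1-\zeta)/d$, $$\lim_{n\to\infty}\mathbb{P}\big({\rm diam}(G_n)\ge \ln^{\nu} n\big)=1;$$ furthermore, if $\sigma>0$ is small enough (i.e. $\sigma\le\sigma_2$ for some $\sigma_2>0$ depending only on $d,\alpha,\beta,\zeta$), then $$\lim_{n\to\infty}\mathbb{P}\big({\rm diam}(G_n)\ge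 \ln^{(1-\zeta)/d} n\big)=1.$$
   Context: Here $\ln$ is the natural logarithm and $\ln^{s} n:=(\ln n)^{s}$. $T_n^d$ is the $d$-dimensional lattice torus obtained from $\mathbb{Z}^d\cap[0,n]^d$ by identifying opposite faces; it has $n^d$ vertices and nearest-neighbour edges. $d^T_\infty$ is the $l_\infty$ metric on the torus: $d^T_\infty(x,y)=\max_{1\le s\le d}\min(|x_s-y_s|,n-|x_s-y_s|)$. The modified Newman-Watts graph $G_n=G_n(\alpha,\beta,\sigma,\zeta)=(V_n,E_n)$ is the random graph with vertex set $V_n=T_n^d$ containing all (nearest-neighbour) edges of $T_n^d$ and, in addition, for each unordered pair $\{u,v\}\subset V_n$ with $\alpha n\le d^T_\infty(u,v)\le\beta n$, independently over pairs, a "long edge" joining $u$ and $v$ with probability $p_n=\sigma n^{-d}\ln^{\zeta}n$ ($n$ is taken large enough that $p_n\le 1$). The diameter is the maximum, over pairs of vertices, of the number of edges in a shortest path between them. *)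

theory Defs
  imports "HOL-Probability.Probability" "HOL-Probability.Product_PMF"
begin

text \<open>
  Finite simple graphs are given by a vertex set and a set of unordered pairs \<open>{u, v}\<close>.
\<close>

definition is_path :: "'v set \<Rightarrow> 'v set set \<Rightarrow> 'v \<Rightarrow> 'v list \<Rightarrow> 'v \<Rightarrow> bool" where
  "is_path V E u p v \<longleftrightarrow>
     p \<noteq> [] \<and> hd p = u \<and> last p = v \<and> distinct p \<and> set p \<subseteq> V \<and>
     successively (\<lambda>x y. {x, y} \<in> E) p"

text \<open>
  The least number of edges of a path; a path listed as \<open>p\<close> has \<open>length p - 1\<close> edges.
  The value is meaningful only if \<open>u\<close> and \<open>v\<close> are connected, which is always the case
  below, since the random graph contains the torus.
\<close>

definition graph_dist :: "'v set \<Rightarrow> 'v set set \<Rightarrow> 'v \<Rightarrow> 'v \<Rightarrow> nat" where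
  "graph_dist V E u v = (LEAST k. \<exists>p. is_path V E u p v \<and> length p - 1 = k)"

definition graph_diam :: "'v set \<Rightarrow> 'v set set \<Rightarrow> nat" where
  "graph_diam V E = Max {graph_dist V E u v | u v. u \<in> V \<and> v \<in> V}"

text \<open>
  After identification of opposite faces, every vertex of the torus has a unique
  representative with coordinates in \<open>{0, \<dots>, n - 1}\<close>; coordinates are indexed by \<open>s < d\<close>.
\<close>

definition torus_verts :: "nat \<Rightarrow> nat \<Rightarrow> (nat \<Rightarrow> nat) set" where
  "torus_verts d n = (\<Pi>\<^sub>E s\<in>{..<d}. {..<n})"

definition torus_edges :: "nat \<Rightarrow> nat \<Rightarrow> (nat \<Rightarrow> nat) set set" where
  "torus_edges d n =
     {{x, x(s := (x s + 1) mod n)} | x s. x \<in> torus_verts d n \<and> s < d}"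

definition torus_dist :: "nat \<Rightarrow> nat \<Rightarrow> (nat \<Rightarrow> nat) \<Rightarrow> (nat \<Rightarrow> nat) \<Rightarrow> int" where
  "torus_dist d n x y =
     Max ((\<lambda>s. min \<bar>int (x s) - int (y s)\<bar> (int n - \<bar>int (x s) - int (y s)\<bar>)) ` {..<d})"

definition long_pairs :: "nat \<Rightarrow> real \<Rightarrow> real \<Rightarrow> nat \<Rightarrow> (nat \<Rightarrow> nat) set set" where
  "long_pairs d \<alpha> \<beta> n =
     {{u, v} | u v. u \<in> torus_verts d n \<and> v \<in> torus_verts d n \<and> u \<noteq> v \<and>
        \<alpha> * real n \<le> real_of_int (torus_dist d n u v) \<and>
        real_of_int (torus_dist d n u v) \<le> \<beta> * real n}"

definition long_edge_prob :: "nat \<Rightarrow> real \<Rightarrow> real \<Rightarrow> nat \<Rightarrow> real" where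
  "long_edge_prob d \<sigma> \<zeta> n = \<sigma> * real n powr (- real d) * (ln (real n)) powr \<zeta>"

text \<open>
  The law of the random edge set \<open>E\<^sub>n\<close>. For the finitely many \<open>n\<close> with
  \<open>long_edge_prob d \<sigma> \<zeta> n > 1\<close>, \<open>bernoulli_pmf\<close> replaces the parameter by \<open>1\<close>.
\<close>

definition newman_watts ::
  "nat \<Rightarrow> real \<Rightarrow> real \<Rightarrow> real \<Rightarrow> real \<Rightarrow> nat \<Rightarrow> (nat \<Rightarrow> nat) set set pmf" where
  "newman_watts d \<alpha> \<beta> \<sigma> \<zeta> n =
     map_pmf (\<lambda>present. torus_edges d n \<union> {e \<in> long_pairs d \<alpha> \<beta> n. present e})
       (Pi_pmf (long_pairs d \<alpha> \<beta> n) False (\<lambda>_. bernoulli_pmf (long_edge_prob d \<sigma> \<zeta> n)))"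

end

theory Submission
  imports Defs "HOL-Real_Asymp.Real_Asymp"
begin

text \<open>
  Upper bounds. Cut the torus into cubic blocks of side \<open>L\<close>, where \<open>L = 1\<close> if \<open>\<zeta> \<ge> 1\<close> and
  \<open>L\<close> is about \<open>ln n\<close> otherwise, so that a block sends out a large multiple of \<open>ln n\<close> long edges
  on average. Since \<open>\<Gamma> > 1/2\<close>, every vertex has a positive fraction of all vertices as potential long
  neighbours outside any given set that is not much larger than half of the torus. A union bound
  over pairs of sets of blocks then shows that, with high probability, every set of at most
  half of the blocks expands by a constant factor. Balls in the block graph therefore exceed half of
  it after \<open>O(ln n)\<close> steps, any two of them meet, and the diameter is \<open>O(L ln n)\<close>.

  Lower bounds. Place about \<open>sqrt n\<close> disjoint cubes of side about \<open>2 (ln n) powr \<nu>\<close> inside a region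
  of diameter below \<open>\<alpha> n\<close>. No long pair joins two of them, so the events that a cube meets no
  long edge are independent, and each has probability at least \<open>n powr (-1/4)\<close>. Hence some cube is
  isolated with high probability, and leaving it from its centre takes \<open>(ln n) powr \<nu>\<close> steps.
\<close>

section \<open>Paths and the torus graph\<close>

text \<open>Adding \<open>Id\<close> makes the \<open>k\<close>-th power mean reachability in at
  most \<open>k\<close> steps. Walks compose freely, whereas \<open>is_path\<close> insists on
  distinct vertices, so reachability is argued with walks and converted to paths once.\<close>

definition near :: "'v set \<Rightarrow> 'v set set \<Rightarrow> nat \<Rightarrow> ('v \<times> 'v) set" where
  "near V E k = ({(x, y). x \<in> V \<and> y \<in> V \<and> {x, y} \<in> E} \<union> Id) ^^ k"

lemma near_edge: "x \<in> V \<Longrightarrow> y \<in> V \<Longrightarrow> {x, y} \<in> E \<Longrightarrow> (x, y) \<in> near V E 1"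
  unfolding near_def by auto

lemma near_trans: "(x, y) \<in> near V E j \<Longrightarrow> (y, z) \<in> near V E k \<Longrightarrow> (x, z) \<in> near V E (j + k)"
  unfolding near_def by (auto simp: relpow_add)

lemma near_refl: "(x, x) \<in> near V E k"
  unfolding near_def by (induction k) auto

lemma near_mono: "(x, y) \<in> near V E j \<Longrightarrow> j \<le> k \<Longrightarrow> (x, y) \<in> near V E k"
  using near_trans[OF _ near_refl, of x y V E j "k - j"] by simp

lemma near_sym: "(x, y) \<in> near V E k \<Longrightarrow> (y, x) \<in> near V E k"
proof (induction k arbitrary: y)
  case 0
  then show ?case by (simp add: near_def)
next
  case (Suc k)
  then obtain z where z: "(x, z) \<in> near V E k" "z = y \<or> z \<in> V \<and> y \<in> V \<and> {z, y} \<in> E"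
    unfolding near_def by auto
  from z(2) have "(y, z) \<in> near V E 1"
    using near_refl near_edge[of y V z E] by (auto simp: insert_commute)
  with Suc.IH[OF z(1)] show ?case
    using near_trans[of y z V E 1 x k] by simp
qed

lemma is_path_snoc:
  assumes "is_path V E u p w" "w \<in> V" "v \<in> V" "{w, v} \<in> E" "v \<notin> set p"
  shows "is_path V E u (p @ [v]) v"
  using assms unfolding is_path_def by (auto simp: successively_append_iff)

lemma is_path_prefix:
  assumes "is_path V E u p w" "v \<in> set p"
  obtains q where "is_path V E u q v" "length q \<le> length p"
proof -
  obtain xs ys where "p = xs @ v # ys"
    using assms(2) by (meson split_list)
  hence p: "p = (xs @ [v]) @ ys" by simp
  have "is_path V E u (xs @ [v]) v"
    using assms(1) unfolding is_path_def p successively_append_iff[of _ "xs @ [v]"]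
    by (auto simp: hd_append)
  thus ?thesis using that p by auto
qed

text \<open>Follow the walk edge by edge: if the next vertex already lies on the path built so far,
  cut the path there; otherwise append it.\<close>

lemma near_imp_path:
  assumes "u \<in> V" "(u, v) \<in> near V E k"
  shows "\<exists>p. is_path V E u p v \<and> length p \<le> Suc k"
  using assms(2)
proof (induction k arbitrary: v)
  case 0
  then have "is_path V E u [u] v" using assms(1) by (simp add: near_def is_path_def)
  then show ?case by fastforce
next
  case (Suc k)
  then obtain w where w: "(u, w) \<in> near V E k" "w = v \<or> w \<in> V \<and> v \<in> V \<and> {w, v} \<in> E"
    unfolding near_def by auto
  obtain p where p: "is_path V E u p w" "length p \<le> Suc k"
    using Suc.IH[OF w(1)] by auto
  show ?case
  proof (cases "v \<in> set p")
    case True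
    obtain q where "is_path V E u q v" "length q \<le> length p"
      using is_path_prefix[OF p(1) True] .
    then show ?thesis using p(2) by (intro exI[of _ q]) auto
  next
    case False
    then have "w \<noteq> v" using p(1) unfolding is_path_def by auto
    then have "is_path V E u (p @ [v]) v" using is_path_snoc[OF p(1)] w(2) False by auto
    then show ?thesis using p(2) by (intro exI[of _ "p @ [v]"]) auto
  qed
qed

lemma graph_dist_le:
  assumes "u \<in> V" "(u, v) \<in> near V E k"
  shows "graph_dist V E u v \<le> k"
proof -
  obtain p where p: "is_path V E u p v" "length p \<le> Suc k"
    using near_imp_path[OF assms] by auto
  have "graph_dist V E u v \<le> length p - 1"
    unfolding graph_dist_def using p(1) by (intro Least_le) auto
  with p(2) show ?thesis by simp
qed

text \<open>The \<open>LEAST\<close> in \<open>graph_dist\<close> carries information only if some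
  path exists; any walk supplies one.\<close>

lemma graph_dist_attained:
  assumes "u \<in> V" "(u, v) \<in> near V E k"
  obtains p where "is_path V E u p v" "length p - 1 = graph_dist V E u v"
proof -
  have "\<exists>j p. is_path V E u p v \<and> length p - 1 = j"
    using near_imp_path[OF assms] by auto
  then have "\<exists>p. is_path V E u p v \<and> length p - 1 = graph_dist V E u v"
    unfolding graph_dist_def by (rule LeastI_ex)
  then show ?thesis using that by blast
qed

lemma graph_dist_set: "{graph_dist V E u v | u v. u \<in> V \<and> v \<in> V} = (\<lambda>(u, v). graph_dist V E u v) ` (V \<times> V)"
  by auto

lemma graph_diam_le:
  assumes "finite V" "V \<noteq> {}" "\<And>u v. u \<in> V \<Longrightarrow> v \<in> V \<Longrightarrow> (u, v) \<in> near V E k"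
  shows "graph_diam V E \<le> k"
  unfolding graph_diam_def graph_dist_set
  using assms(1,2) by (subst Max_le_iff) (auto intro!: graph_dist_le assms(3))

lemma graph_diam_ge:
  assumes "finite V" "u \<in> V" "v \<in> V"
  shows "graph_dist V E u v \<le> graph_diam V E"
  unfolding graph_diam_def graph_dist_set using assms by (intro Max_ge) auto

text \<open>The invariant is indexed by the number of edges used, and its step is required only for
  the first \<open>K\<close> edges. It serves to show that a path starting at the centre of an
  isolated cube moves away slowly.\<close>

lemma path_invariant:
  assumes "is_path V E u p v" "length p - 1 \<le> K" "Q 0 u"
    and step: "\<And>k x y. k < K \<Longrightarrow> x \<in> V \<Longrightarrow> y \<in> V \<Longrightarrow> {x, y} \<in> E \<Longrightarrow> Q k x \<Longrightarrow> Q (Suc k) y"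
  shows "Q (length p - 1) v"
proof -
  have p: "p \<noteq> []" "p ! 0 = u" "p ! (length p - 1) = v" "set p \<subseteq> V"
    "successively (\<lambda>x y. {x, y} \<in> E) p"
    using assms(1) unfolding is_path_def by (auto simp: hd_conv_nth last_conv_nth)
  have "i < length p \<Longrightarrow> Q i (p ! i)" for i
  proof (induction i)
    case 0
    then show ?case using p assms(3) by simp
  next
    case (Suc i)
    then show ?case
      using step[of i "p ! i" "p ! Suc i"] p(4,5) assms(2)
      by (auto simp: successively_conv_nth subset_iff)
  qed
  from this[of "length p - 1"] p show ?thesis by simp
qed

section \<open>Vertices and walks of the torus\<close>

lemma finite_torus_verts: "finite (torus_verts d n)"
  unfolding torus_verts_def by (intro finite_PiE) auto

lemma card_torus_verts: "card (torus_verts d n) = n ^ d"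
  unfolding torus_verts_def by (simp add: card_PiE)

lemma torus_verts_upd: "x \<in> torus_verts d n \<Longrightarrow> s < d \<Longrightarrow> a < n \<Longrightarrow> x(s := a) \<in> torus_verts d n"
  unfolding torus_verts_def by (auto simp: PiE_iff extensional_def)

lemma torus_verts_eqI:
  "x \<in> torus_verts d n \<Longrightarrow> y \<in> torus_verts d m \<Longrightarrow> (\<And>s. s < d \<Longrightarrow> x s = y s) \<Longrightarrow> x = y"
  unfolding torus_verts_def by (rule extensionalityI[of _ "{..<d}"]) (auto simp: PiE_iff)

lemma torus_verts_less: "x \<in> torus_verts d n \<Longrightarrow> s < d \<Longrightarrow> x s < n"
  unfolding torus_verts_def by auto

lemma torus_edge_succ:
  assumes "x \<in> torus_verts d n" "s < d" "Suc (x s) < n"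
  shows "{x, x(s := Suc (x s))} \<in> torus_edges d n"
proof -
  have "x(s := Suc (x s)) = x(s := (x s + 1) mod n)" using assms(3) by simp
  then have "{x, x(s := Suc (x s))} = {x, x(s := (x s + 1) mod n)}" by (rule arg_cong)
  then show ?thesis unfolding torus_edges_def using assms(1,2) by (intro CollectI exI conjI)
qed

text \<open>Move one coordinate at a time straight towards its target, never wrapping around. The
  number of steps is the l_1 distance of the representatives, which suffices for upper
  bounds.\<close>

lemma near_torus:
  assumes "x \<in> torus_verts d n" "y \<in> torus_verts d n" "torus_edges d n \<subseteq> E"
  shows "(x, y) \<in> near (torus_verts d n) E (\<Sum>s<d. nat \<bar>int (x s) - int (y s)\<bar>)"
  using assms(1)
proof (induction "\<Sum>s<d. nat \<bar>int (x s) - int (y s)\<bar>" arbitrary: x)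
  case 0
  then have "\<forall>s<d. x s = y s" by auto
  then show ?case using torus_verts_eqI[OF 0(2) assms(2)] near_refl by simp
next
  case (Suc k)
  have "\<exists>s<d. x s \<noteq> y s"
  proof (rule ccontr)
    assume "\<not> (\<exists>s<d. x s \<noteq> y s)"
    then have "(\<Sum>s<d. nat \<bar>int (x s) - int (y s)\<bar>) = 0" by (intro sum.neutral) auto
    with Suc(2) show False by linarith
  qed
  then obtain s where s: "s < d" "x s \<noteq> y s" by auto
  \<comment> \<open>The value next to \<open>x s\<close> on the side of \<open>y s\<close>:
    replacing \<open>x s\<close> by it lowers the l_1 distance by exactly one.\<close>
  define a where "a = (if x s < y s then Suc (x s) else x s - 1)"
  have lt: "x s < n" "y s < n" using s(1) Suc.prems assms(2) torus_verts_less by auto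
  have an: "a < n" using lt by (auto simp: a_def)
  have xa: "x(s := a) \<in> torus_verts d n" using torus_verts_upd[OF Suc.prems s(1) an] .
  have edge: "{x, x(s := a)} \<in> torus_edges d n"
  proof (cases "x s < y s")
    case True
    then show ?thesis using torus_edge_succ[OF Suc.prems s(1)] lt by (auto simp: a_def)
  next
    case False
    \<comment> \<open>\<open>torus_edges\<close> lists each edge from its lower end, so a descending
      move is the successor edge of the new vertex.\<close>
    then have "(x(s := a))(s := Suc ((x(s := a)) s)) = x" "Suc ((x(s := a)) s) < n"
      using s(2) lt by (auto simp: a_def)
    then show ?thesis using torus_edge_succ[OF xa s(1)] by (simp only: insert_commute)
  qed
  have "(\<Sum>t<d. nat \<bar>int (x t) - int (y t)\<bar>) =
      nat \<bar>int (x s) - int (y s)\<bar> + (\<Sum>t\<in>{..<d} - {s}. nat \<bar>int (x t) - int (y t)\<bar>)"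
    using s(1) by (intro sum.remove) auto
  moreover have "(\<Sum>t<d. nat \<bar>int ((x(s := a)) t) - int (y t)\<bar>) =
      nat \<bar>int a - int (y s)\<bar> + (\<Sum>t\<in>{..<d} - {s}. nat \<bar>int ((x(s := a)) t) - int (y t)\<bar>)"
    using s(1) by (subst sum.remove[of _ s]) auto
  moreover have "(\<Sum>t\<in>{..<d} - {s}. nat \<bar>int ((x(s := a)) t) - int (y t)\<bar>) =
      (\<Sum>t\<in>{..<d} - {s}. nat \<bar>int (x t) - int (y t)\<bar>)"
    by (intro sum.cong) auto
  moreover have "nat \<bar>int (x s) - int (y s)\<bar> = Suc (nat \<bar>int a - int (y s)\<bar>)"
    using s(2) by (auto simp: a_def)
  ultimately have k: "k = (\<Sum>t<d. nat \<bar>int ((x(s := a)) t) - int (y t)\<bar>)"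
    using Suc(2) by linarith
  have "(x(s := a), y) \<in> near (torus_verts d n) E k"
    using Suc(1)[OF k xa] k by simp
  moreover have "(x, x(s := a)) \<in> near (torus_verts d n) E 1"
    using edge assms(3) by (intro near_edge Suc.prems xa) auto
  ultimately have "(x, y) \<in> near (torus_verts d n) E (1 + k)" by (rule near_trans[rotated])
  then show ?case using Suc(2) by simp
qed

section \<open>Random long edges\<close>

text \<open>This is a product event: coordinates in \<open>A\<close> are forced to
  \<open>False\<close>, the others are free and contribute a factor 1.\<close>

lemma prob_all_absent:
  assumes "finite P" "A \<subseteq> P" "0 \<le> p" "p \<le> 1"
  shows "measure_pmf.prob (Pi_pmf P False (\<lambda>_. bernoulli_pmf p)) {f. \<forall>e\<in>A. \<not> f e} = (1 - p) ^ card A"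
proof -
  have "{f. \<forall>e\<in>A. \<not> f e} = Pi P (\<lambda>e. if e \<in> A then {False} else UNIV)"
    using assms(2) by (auto simp: Pi_iff) (metis singletonD subsetD)
  then have "measure_pmf.prob (Pi_pmf P False (\<lambda>_. bernoulli_pmf p)) {f. \<forall>e\<in>A. \<not> f e} =
      (\<Prod>e\<in>P. measure_pmf.prob (bernoulli_pmf p) (if e \<in> A then {False} else UNIV))"
    using measure_Pi_pmf_Pi[OF assms(1)] by simp
  also have "\<dots> = (\<Prod>e\<in>P. if e \<in> A then 1 - p else 1)"
    using assms(3,4) by (intro prod.cong) (auto simp: measure_pmf_single)
  also have "\<dots> = (\<Prod>e\<in>P \<inter> A. 1 - p)"
    using assms(1) by (rule prod.inter_restrict[symmetric])
  also have "P \<inter> A = A" using assms(2) by auto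
  finally show ?thesis by simp
qed

text \<open>Independence enters as the product formula for all subfamilies. Indices move one by one
  to the complemented side: the event for \<open>F\<close> and \<open>insert k K\<close> is the
  event for \<open>F\<close> and \<open>K\<close> minus the event for \<open>insert k F\<close> and
  \<open>K\<close>. Hence \<open>F\<close> is general in the induction.\<close>

lemma prob_complements_of_independent:
  fixes M :: "'a pmf" and D :: "'i \<Rightarrow> 'a \<Rightarrow> bool" and q :: "'i \<Rightarrow> real"
  assumes "\<And>F. F \<subseteq> L \<Longrightarrow> measure_pmf.prob M {f. \<forall>j\<in>F. D j f} = (\<Prod>j\<in>F. q j)"
    and "finite L" "K \<subseteq> L" "F \<subseteq> L" "F \<inter> K = {}"
  shows "measure_pmf.prob M {f. (\<forall>j\<in>F. D j f) \<and> (\<forall>j\<in>K. \<not> D j f)} = (\<Prod>j\<in>F. q j) * (\<Prod>j\<in>K. 1 - q j)"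
proof -
  have "finite K" using assms(2,3) finite_subset by auto
  then show ?thesis using assms(3-5)
  proof (induction K arbitrary: F rule: finite_induct)
    case empty
    then show ?case using assms(1) by simp
  next
    case (insert k K)
    let ?X = "\<lambda>F. {f. (\<forall>j\<in>F. D j f) \<and> (\<forall>j\<in>K. \<not> D j f)}"
    have fF: "finite F" using insert.prems assms(2) finite_subset by auto
    have "{f. (\<forall>j\<in>F. D j f) \<and> (\<forall>j\<in>insert k K. \<not> D j f)} = ?X F - ?X (insert k F)"
      by auto
    then have "measure_pmf.prob M {f. (\<forall>j\<in>F. D j f) \<and> (\<forall>j\<in>insert k K. \<not> D j f)} =
        measure_pmf.prob M (?X F) - measure_pmf.prob M (?X (insert k F))"
      by (simp only:) (rule measure_pmf.finite_measure_Diff, auto)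
    also have "measure_pmf.prob M (?X F) = (\<Prod>j\<in>F. q j) * (\<Prod>j\<in>K. 1 - q j)"
      using insert.prems by (intro insert.IH) auto
    also have "measure_pmf.prob M (?X (insert k F)) = (\<Prod>j\<in>insert k F. q j) * (\<Prod>j\<in>K. 1 - q j)"
      using insert.prems insert.hyps by (intro insert.IH) auto
    also have "(\<Prod>j\<in>insert k F. q j) = q k * (\<Prod>j\<in>F. q j)"
      using insert.prems fF by (intro prod.insert) auto
    finally show ?case using insert.hyps by (simp add: algebra_simps)
  qed
qed

lemma finite_long_pairs: "finite (long_pairs d \<alpha> \<beta> n)"
proof -
  have "long_pairs d \<alpha> \<beta> n \<subseteq> (\<lambda>(u, v). {u, v}) ` (torus_verts d n \<times> torus_verts d n)"
    unfolding long_pairs_def by auto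
  then show ?thesis using finite_torus_verts finite_subset by blast
qed

text \<open>Pulls events about the edge set back to the presence function, whose coordinates are
  independent.\<close>

lemma newman_watts_prob:
  "measure_pmf.prob (newman_watts d \<alpha> \<beta> \<sigma> \<zeta> n) {E. Q E} =
   measure_pmf.prob (Pi_pmf (long_pairs d \<alpha> \<beta> n) False (\<lambda>_. bernoulli_pmf (long_edge_prob d \<sigma> \<zeta> n)))
     {f. Q (torus_edges d n \<union> {e \<in> long_pairs d \<alpha> \<beta> n. f e})}"
  unfolding newman_watts_def by (simp add: vimage_def)

lemma long_edge_prob_nonneg: "\<sigma> > 0 \<Longrightarrow> 0 \<le> long_edge_prob d \<sigma> \<zeta> n"
  unfolding long_edge_prob_def by simp

lemma eventually_long_edge_prob_le:
  assumes "d \<ge> 1" "\<sigma> > 0" "\<epsilon> > 0"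
  shows "\<forall>\<^sub>F n in sequentially. long_edge_prob d \<sigma> \<zeta> n \<le> \<epsilon>"
proof -
  define D where "D = real d"
  have "D > 0" using assms(1) by (simp add: D_def)
  then have "(\<lambda>n. \<sigma> * real n powr (- D) * ln (real n) powr \<zeta>) \<longlonglongrightarrow> 0"
    by real_asymp
  then have "\<forall>\<^sub>F n in sequentially. \<sigma> * real n powr (- D) * ln (real n) powr \<zeta> < \<epsilon>"
    using assms(3) by (simp add: order_tendsto_iff)
  then show ?thesis
    unfolding long_edge_prob_def D_def by (rule eventually_mono) auto
qed

lemma torus_dist_le:
  assumes "d \<ge> 1" "\<And>s. s < d \<Longrightarrow> \<bar>int (x s) - int (y s)\<bar> \<le> k"
  shows "torus_dist d n x y \<le> k"
proof -
  have "{..<d} \<noteq> {}" using assms(1) by (auto simp: lessThan_empty_iff)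
  then show ?thesis
    unfolding torus_dist_def using assms(2)
    by (intro Max.boundedI) (auto simp: min_le_iff_disj)
qed

section \<open>Isolated cubes\<close>

definition cube :: "nat \<Rightarrow> (nat \<Rightarrow> nat) \<Rightarrow> nat \<Rightarrow> (nat \<Rightarrow> nat) set" where
  "cube d a L = (\<Pi>\<^sub>E s\<in>{..<d}. {a s..<a s + L})"

lemma card_cube: "card (cube d a L) = L ^ d"
  unfolding cube_def by (simp add: card_PiE)

lemma finite_cube: "finite (cube d a L)"
  unfolding cube_def by (intro finite_PiE) auto

lemma cube_subset_torus: "(\<And>s. s < d \<Longrightarrow> a s + L \<le> n) \<Longrightarrow> cube d a L \<subseteq> torus_verts d n"
  unfolding cube_def torus_verts_def by (intro PiE_mono) fastforce

text \<open>As long as a path from the centre \<open>c\<close> has used fewer than \<open>R\<close>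
  edges it is inside the cube, where only torus edges are available, and each changes every
  coordinate by at most 1. So reaching \<open>v\<close>, at distance \<open>R\<close> from
  \<open>c\<close> along coordinate 0, takes at least \<open>R\<close> edges.\<close>

lemma graph_diam_ge_of_isolated_cube:
  assumes "d \<ge> 1" and c: "\<And>s. s < d \<Longrightarrow> a s + (2 * R + 1) \<le> n"
    and iso: "\<And>e. e \<in> F \<Longrightarrow> e \<inter> cube d a (2 * R + 1) = {}"
  shows "R \<le> graph_diam (torus_verts d n) (torus_edges d n \<union> F)"
proof -
  define V where "V = torus_verts d n"
  define E where "E = torus_edges d n \<union> F"
  define c where "c = restrict (\<lambda>s. a s + R) {..<d}"
  define v where "v = c(0 := a 0 + 2 * R)"
  have cV: "c \<in> V"
    unfolding V_def torus_verts_def c_def restrict_PiE_iff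
  proof
    fix s assume "s \<in> {..<d}"
    then show "a s + R \<in> {..<n}" using assms(2)[of s] by simp
  qed
  have vV: "v \<in> V"
    unfolding V_def v_def
  proof (rule torus_verts_upd)
    show "c \<in> torus_verts d n" using cV by (simp add: V_def)
    show "a 0 + 2 * R < n" using assms(1) assms(2)[of 0] by simp
  qed (use assms(1) in simp)
  \<comment> \<open>After \<open>k\<close> edges the path is within l_infinity distance
    \<open>k\<close> of the centre, measured without wrapping.\<close>
  let ?Q = "\<lambda>k x. \<forall>s<d. \<bar>int (x s) - int (c s)\<bar> \<le> int k"
  have "(c, v) \<in> near V E (\<Sum>s<d. nat \<bar>int (c s) - int (v s)\<bar>)"
    unfolding V_def E_def using cV vV by (intro near_torus) (auto simp: V_def)
  then obtain p where p: "is_path V E c p v" "length p - 1 = graph_dist V E c v"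
    using graph_dist_attained[OF cV] by metis
  have "R \<le> length p - 1"
  proof (rule ccontr)
    assume less: "\<not> R \<le> length p - 1"
    have "?Q (length p - 1) v"
    proof (rule path_invariant[OF p(1), of R ?Q])
      show "length p - 1 \<le> R" using less by simp
      show "?Q 0 c" by simp
      fix k x y assume k: "k < R" and xy: "x \<in> V" "y \<in> V" "{x, y} \<in> E" and Q: "?Q k x"
      \<comment> \<open>Both inequalities are strict because \<open>k < R\<close>: this leaves room
        for one more step on either side without wrapping around.\<close>
      have x: "a s < x s \<and> x s < a s + 2 * R" if "s < d" for s
        using Q k that by (auto simp: c_def)
      have "x s \<in> {a s..<a s + (2 * R + 1)}" if "s < d" for s
        using x[OF that] by auto
      then have "x \<in> cube d a (2 * R + 1)"
        using xy(1) unfolding cube_def V_def torus_verts_def by (auto simp: PiE_iff)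
      then have "{x, y} \<in> torus_edges d n" using iso[of "{x, y}"] xy(3) by (auto simp: E_def)
      then obtain z s where zs: "{x, y} = {z, z(s := (z s + 1) mod n)}" "z \<in> V" "s < d"
        unfolding torus_edges_def V_def by auto
      show "?Q (Suc k) y"
      proof (cases "x = z")
        case True
        then have y: "y = x \<or> y = x(s := (x s + 1) mod n)" using zs(1) by (auto simp: doubleton_eq_iff)
        have "x s + 1 < n" using x[OF zs(3)] assms(2)[OF zs(3)] by simp
        then have "(x s + 1) mod n = x s + 1" by simp
        then have xy1: "\<bar>int (y t) - int (x t)\<bar> \<le> 1" for t
          using y by (cases "t = s") auto
        show ?thesis
        proof (intro allI impI)
          fix t assume "t < d"
          then have "\<bar>int (x t) - int (c t)\<bar> \<le> int k" using Q by blast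
          then show "\<bar>int (y t) - int (c t)\<bar> \<le> int (Suc k)" using xy1[of t] by linarith
        qed
      next
        case False
        then have y: "y = z" "x = z(s := (z s + 1) mod n)" using zs(1) by (auto simp: doubleton_eq_iff)
        have "z s < n" using zs(2,3) torus_verts_less unfolding V_def by auto
        \<comment> \<open>Positivity rules out the wrap-around edge, which would lead from
          \<open>n - 1\<close> to \<open>0\<close>.\<close>
        moreover have "x s > 0" using x[OF zs(3)] by simp
        ultimately have "x s = z s + 1" using y by (cases "z s + 1 = n") auto
        show ?thesis
        proof (intro allI impI)
          fix t assume "t < d"
          then have "\<bar>int (x t) - int (c t)\<bar> \<le> int k" using Q by blast
          moreover have "\<bar>int (y t) - int (x t)\<bar> \<le> 1"
            using y \<open>x s = z s + 1\<close> by (cases "t = s") auto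
          ultimately show "\<bar>int (y t) - int (c t)\<bar> \<le> int (Suc k)" by linarith
        qed
      qed
    qed
    then have "\<bar>int (v 0) - int (c 0)\<bar> \<le> int (length p - 1)" using assms(1) by auto
    moreover have "int (v 0) - int (c 0) = int R" using assms(1) by (simp add: v_def c_def)
    ultimately show False using less by linarith
  qed
  then have "R \<le> graph_dist V E c v" using p(2) by simp
  also have "\<dots> \<le> graph_diam V E"
    using cV vV finite_torus_verts unfolding V_def by (intro graph_diam_ge) auto
  finally show ?thesis unfolding V_def E_def .
qed

text \<open>Such a pair is determined by an end in \<open>C\<close> and an arbitrary other
  end.\<close>

lemma card_long_pairs_meeting:
  assumes "finite C"
  shows "card {e \<in> long_pairs d \<alpha> \<beta> n. e \<inter> C \<noteq> {}} \<le> card C * n ^ d"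
proof -
  have "{e \<in> long_pairs d \<alpha> \<beta> n. e \<inter> C \<noteq> {}} \<subseteq> (\<lambda>(u, v). {u, v}) ` (C \<times> torus_verts d n)"
  proof
    fix e assume "e \<in> {e \<in> long_pairs d \<alpha> \<beta> n. e \<inter> C \<noteq> {}}"
    then obtain u v where "e = {u, v}" "u \<in> torus_verts d n" "v \<in> torus_verts d n" "u \<in> C \<or> v \<in> C"
      unfolding long_pairs_def by auto
    then show "e \<in> (\<lambda>(u, v). {u, v}) ` (C \<times> torus_verts d n)"
      by (auto simp: image_iff insert_commute)
  qed
  then have "card {e \<in> long_pairs d \<alpha> \<beta> n. e \<inter> C \<noteq> {}} \<le>
      card ((\<lambda>(u, v). {u, v}) ` (C \<times> torus_verts d n))"
    using assms finite_torus_verts by (intro card_mono finite_imageI finite_cartesian_product)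
  also have "\<dots> \<le> card (C \<times> torus_verts d n)"
    using assms finite_torus_verts by (intro card_image_le) auto
  finally show ?thesis by (simp add: card_cartesian_product card_torus_verts)
qed

text \<open>Turns the probability that a cube is isolated, a power of \<open>1 - p\<close>, into an
  exponential lower bound.\<close>

lemma exp_minus_double_le:
  fixes p :: real
  assumes "0 \<le> p" "p \<le> 1 / 2"
  shows "exp (- 2 * p) \<le> 1 - p"
proof -
  have "- 2 * p \<le> - p - 2 * p\<^sup>2"
    using mult_left_mono[OF assms(2,1)] by (simp add: power2_eq_square)
  also have "\<dots> \<le> ln (1 - p)" using ln_one_minus_pos_lower_bound[OF assms] .
  finally have "exp (- 2 * p) \<le> exp (ln (1 - p))" by simp
  then show ?thesis using assms by simp
qed

text \<open>Line up \<open>m\<close> cubes along coordinate 0. Together they fit in a box of side at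
  most \<alpha> n, so no long pair meets two of them, and their isolation events involve disjoint
  sets of pairs and are independent. A diameter below \<open>R\<close> means that no cube is
  isolated, which has probability at most the product of the factors 1 - (1 - p)^K, where
  \<open>K\<close> bounds the number of long pairs meeting a cube.\<close>

lemma prob_diam_less_le:
  assumes "d \<ge> 1" "\<alpha> < 1" "\<sigma> > 0" and m: "real (m * (2 * R + 1)) \<le> \<alpha> * real n"
    and p: "p = long_edge_prob d \<sigma> \<zeta> n" "p \<le> 1 / 2"
  shows "measure_pmf.prob (newman_watts d \<alpha> \<beta> \<sigma> \<zeta> n) {E. graph_diam (torus_verts d n) E < R} \<le>
    exp (- real m * exp (- 2 * p * real ((2 * R + 1) ^ d * n ^ d)))"
proof -
  define P where "P = long_pairs d \<alpha> \<beta> n"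
  define M where "M = Pi_pmf P False (\<lambda>_. bernoulli_pmf p)"
  define a where "a = (\<lambda>i (s::nat). if s = 0 then i * (2 * R + 1) else (0::nat))"
  define A where "A = (\<lambda>i. {e \<in> P. e \<inter> cube d (a i) (2 * R + 1) \<noteq> {}})"
  define D where "D = (\<lambda>i f. \<forall>e\<in>A i. \<not> f e)"
  define K where "K = (2 * R + 1) ^ d * n ^ d"
  have p0: "0 \<le> p" using p(1) assms(3) long_edge_prob_nonneg by simp
  have finP: "finite P" unfolding P_def by (rule finite_long_pairs)
  have le_m: "a i s + (2 * R + 1) \<le> m * (2 * R + 1)" if "i < m" for i s
  proof -
    have "(i + 1) * (2 * R + 1) \<le> m * (2 * R + 1)" using that by (intro mult_le_mono1) simp
    then show ?thesis unfolding a_def by simp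
  qed
  have "\<alpha> * real n \<le> 1 * real n" using assms(2) by (intro mult_right_mono) auto
  then have mn: "m * (2 * R + 1) \<le> n" using m by linarith
  have disj: "A i \<inter> A j = {}" if ij: "i < m" "j < m" "i \<noteq> j" for i j
  proof (rule ccontr)
    assume "A i \<inter> A j \<noteq> {}"
    then obtain e where e: "e \<in> P" "e \<inter> cube d (a i) (2 * R + 1) \<noteq> {}" "e \<inter> cube d (a j) (2 * R + 1) \<noteq> {}"
      unfolding A_def by auto
    have cubes: "cube d (a i) (2 * R + 1) \<inter> cube d (a j) (2 * R + 1) = {}"
    proof (rule ccontr)
      assume "cube d (a i) (2 * R + 1) \<inter> cube d (a j) (2 * R + 1) \<noteq> {}"
      then obtain x where x: "x \<in> cube d (a i) (2 * R + 1)" "x \<in> cube d (a j) (2 * R + 1)" by auto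
      \<comment> \<open>Dividing coordinate 0 by the side recovers the index of the cube, so the
        cubes are disjoint.\<close>
      have "x 0 div (2 * R + 1) = k" if "x \<in> cube d (a k) (2 * R + 1)" for k
        using PiE_mem[OF that[unfolded cube_def], of 0] assms(1) unfolding a_def
        by (intro div_nat_eqI) (auto simp: algebra_simps)
      then show False using x ij(3) by metis
    qed
    obtain u v where uv: "e = {u, v}" "\<alpha> * real n \<le> real_of_int (torus_dist d n u v)"
      using e(1) unfolding P_def long_pairs_def by auto
    have small: "x s < m * (2 * R + 1)" if "x \<in> cube d (a k) (2 * R + 1)" "k < m" "s < d" for x k s
      using PiE_mem[OF that(1)[unfolded cube_def], of s] le_m[OF that(2), of s] that(3) by auto
    have "u \<in> cube d (a i) (2 * R + 1) \<and> v \<in> cube d (a j) (2 * R + 1) \<or>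
        v \<in> cube d (a i) (2 * R + 1) \<and> u \<in> cube d (a j) (2 * R + 1)"
      using e(2,3) uv(1) cubes by auto
    \<comment> \<open>The two ends lie in two of the cubes, hence in the common box; their distance
      is then below \<alpha> n, too short for a long pair.\<close>
    then have lt: "u s < m * (2 * R + 1)" "v s < m * (2 * R + 1)" if "s < d" for s
      using small[of _ i s] small[of _ j s] ij that by auto
    have "torus_dist d n u v \<le> int (m * (2 * R + 1)) - 1"
    proof (rule torus_dist_le[OF assms(1)])
      fix s assume "s < d"
      from lt[OF this] show "\<bar>int (u s) - int (v s)\<bar> \<le> int (m * (2 * R + 1)) - 1" by linarith
    qed
    then have "real_of_int (torus_dist d n u v) < real (m * (2 * R + 1))" by linarith
    then show False using uv(2) m by linarith
  qed
  have AP: "A i \<subseteq> P" for i unfolding A_def by auto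
  have finA: "finite (A i)" for i using AP finP finite_subset by blast
  have indep: "measure_pmf.prob M {f. \<forall>i\<in>F. D i f} = (\<Prod>i\<in>F. (1 - p) ^ card (A i))" if "F \<subseteq> {..<m}" for F
  proof -
    have "{f. \<forall>i\<in>F. D i f} = {f. \<forall>e\<in>(\<Union>i\<in>F. A i). \<not> f e}" unfolding D_def by auto
    then have "measure_pmf.prob M {f. \<forall>i\<in>F. D i f} = (1 - p) ^ card (\<Union>i\<in>F. A i)"
      unfolding M_def using AP p0 p(2) by (simp only:) (rule prob_all_absent[OF finP], auto)
    \<comment> \<open>Disjointness of the sets \<open>A i\<close> is what yields the exact product
      formula.\<close>
    also have "card (\<Union>i\<in>F. A i) = (\<Sum>i\<in>F. card (A i))"
      using that finA disj finite_subset[OF that] by (intro card_UN_disjoint) (auto simp: subset_iff)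
    finally show ?thesis by (simp add: power_sum)
  qed
  have "measure_pmf.prob (newman_watts d \<alpha> \<beta> \<sigma> \<zeta> n) {E. graph_diam (torus_verts d n) E < R} =
      measure_pmf.prob M {f. graph_diam (torus_verts d n) (torus_edges d n \<union> {e \<in> P. f e}) < R}"
    unfolding M_def P_def p(1) by (rule newman_watts_prob)
  also have "\<dots> \<le> measure_pmf.prob M {f. \<forall>i\<in>{..<m}. \<not> D i f}"
  proof (rule measure_pmf.finite_measure_mono)
    show "{f. graph_diam (torus_verts d n) (torus_edges d n \<union> {e \<in> P. f e}) < R} \<subseteq>
        {f. \<forall>i\<in>{..<m}. \<not> D i f}"
    proof (intro subsetI CollectI ballI notI)
      fix f i assume f: "f \<in> {f. graph_diam (torus_verts d n) (torus_edges d n \<union> {e \<in> P. f e}) < R}"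
        and i: "i \<in> {..<m}" and D: "D i f"
      have "R \<le> graph_diam (torus_verts d n) (torus_edges d n \<union> {e \<in> P. f e})"
      proof (rule graph_diam_ge_of_isolated_cube[OF assms(1)])
        show "a i s + (2 * R + 1) \<le> n" for s using le_m[of i s] i mn by simp
        show "e \<inter> cube d (a i) (2 * R + 1) = {}" if "e \<in> {e \<in> P. f e}" for e
          using that D unfolding D_def A_def by auto
      qed
      then show False using f by simp
    qed
  qed simp
  also have "\<dots> = (\<Prod>i<m. 1 - (1 - p) ^ card (A i))"
    using prob_complements_of_independent[of "{..<m}" M D "\<lambda>i. (1 - p) ^ card (A i)" "{..<m}" "{}"] indep
    by simp
  also have "\<dots> \<le> (\<Prod>i<m. exp (- exp (- 2 * p * real K)))"
  proof (rule prod_mono)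
    fix i assume "i \<in> {..<m}"
    have "card (A i) \<le> K"
      using card_long_pairs_meeting[OF finite_cube, of d \<alpha> \<beta> n d "a i" "2 * R + 1"]
      unfolding A_def P_def K_def card_cube .
    then have "(1 - p) ^ K \<le> (1 - p) ^ card (A i)"
      using p0 p(2) by (intro power_decreasing) auto
    moreover have "exp (- 2 * p * real K) \<le> (1 - p) ^ K"
      using power_mono[OF exp_minus_double_le[OF p0 p(2)], of K] by (simp add: exp_of_nat2_mult[symmetric])
    moreover have "1 - exp (- 2 * p * real K) \<le> exp (- exp (- 2 * p * real K))"
      using exp_ge_add_one_self[of "- exp (- 2 * p * real K)"] by simp
    moreover have "(1 - p) ^ card (A i) \<le> 1" using p0 p(2) by (intro power_le_one) auto
    ultimately show "0 \<le> 1 - (1 - p) ^ card (A i) \<and> 1 - (1 - p) ^ card (A i) \<le> exp (- exp (- 2 * p * real K))"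
      by linarith
  qed
  also have "\<dots> = exp (- real m * exp (- 2 * p * real K))"
    by (simp add: exp_of_nat_mult[symmetric])
  finally show ?thesis unfolding K_def .
qed

text \<open>Hypothesis \<open>ev\<close> bounds the exponent in the isolation probability by (ln n)
  / 4, so each of about sqrt n cubes is isolated with probability at least n^(-1/4), and sqrt n *
  n^(-1/4) tends to infinity. Stated this way, it covers both a subcritical \<nu> with any \<sigma>
  and the critical \<nu> with small \<sigma>.\<close>

lemma prob_diam_ge_tendsto_1:
  assumes "d \<ge> 1" "0 < \<alpha>" "\<alpha> < 1" "\<sigma> > 0" "\<nu> > 0"
    and ev: "\<forall>\<^sub>F n in sequentially. 2 * \<sigma> * 5 ^ d * ln (real n) powr (\<nu> * real d + \<zeta>) \<le> ln (real n) / 4"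
  shows "(\<lambda>n. measure_pmf.prob (newman_watts d \<alpha> \<beta> \<sigma> \<zeta> n)
              {E. real (graph_diam (torus_verts d n) E) \<ge> ln (real n) powr \<nu>}) \<longlonglongrightarrow> 1"
proof -
  define R where "R = (\<lambda>n::nat. nat \<lceil>ln (real n) powr \<nu>\<rceil>)"
  define m where "m = (\<lambda>n::nat. nat \<lfloor>sqrt (real n)\<rfloor>)"
  have ev1: "\<forall>\<^sub>F n in sequentially. ln (real n) \<ge> 1" by real_asymp
  have ev2: "\<forall>\<^sub>F n in sequentially. sqrt (real n) \<ge> 1" by real_asymp
  have ev3: "\<forall>\<^sub>F n in sequentially. sqrt (real n) * (5 * ln (real n) powr \<nu>) \<le> \<alpha> * real n"
    using assms(2) by real_asymp
  have ev4: "\<forall>\<^sub>F n in sequentially. long_edge_prob d \<sigma> \<zeta> n \<le> 1 / 2"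
    using eventually_long_edge_prob_le[OF assms(1,4), of "1/2" \<zeta>] by simp
  have bound: "\<forall>\<^sub>F n in sequentially. 1 - exp (- (sqrt (real n) - 1) * real n powr (- 1 / 4)) \<le>
      measure_pmf.prob (newman_watts d \<alpha> \<beta> \<sigma> \<zeta> n)
        {E. real (graph_diam (torus_verts d n) E) \<ge> ln (real n) powr \<nu>}"
    using ev ev1 ev2 ev3 ev4 eventually_gt_at_top[of 0]
  proof eventually_elim
    case (elim n)
    define p where "p = long_edge_prob d \<sigma> \<zeta> n"
    define \<Lambda> where "\<Lambda> = ln (real n)"
    have \<Lambda>1: "1 \<le> \<Lambda> powr \<nu>" using elim(2) assms(5) unfolding \<Lambda>_def by (intro ge_one_powr_ge_zero) auto
    have R: "\<Lambda> powr \<nu> \<le> real (R n)" "real (R n) \<le> \<Lambda> powr \<nu> + 1"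
      using \<Lambda>1 unfolding R_def \<Lambda>_def by linarith+
    \<comment> \<open>From 2 (t + 1) + 1 \<le> 5 t for t \<ge> 1; this is the origin of the factor
      \<open>5 ^ d\<close> in \<open>ev\<close>.\<close>
    have side: "real (2 * R n + 1) \<le> 5 * \<Lambda> powr \<nu>" using R(2) \<Lambda>1 by simp
    have m: "real (m n) \<le> sqrt (real n)" "sqrt (real n) - 1 \<le> real (m n)" "1 \<le> m n"
      using elim(3) unfolding m_def by linarith+
    have "real (m n * (2 * R n + 1)) \<le> sqrt (real n) * (5 * \<Lambda> powr \<nu>)"
      using m(1) side elim(3) unfolding of_nat_mult by (intro mult_mono) auto
    also have "\<dots> \<le> \<alpha> * real n" using elim(4) unfolding \<Lambda>_def .
    finally have mR: "real (m n * (2 * R n + 1)) \<le> \<alpha> * real n" .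
    \<comment> \<open>The factor \<open>n ^ d\<close> cancels against the power of \<open>n\<close>
      in \<open>p\<close>, leaving only logarithms.\<close>
    have "2 * p * real ((2 * R n + 1) ^ d * n ^ d) = 2 * \<sigma> * \<Lambda> powr \<zeta> * real (2 * R n + 1) ^ d"
      using elim(6) unfolding p_def long_edge_prob_def \<Lambda>_def
      by (simp add: powr_minus powr_realpow field_simps)
    also have "\<dots> \<le> 2 * \<sigma> * \<Lambda> powr \<zeta> * (5 * \<Lambda> powr \<nu>) ^ d"
      using side assms(4) by (intro mult_left_mono power_mono) auto
    also have "(5 * \<Lambda> powr \<nu>) ^ d = 5 ^ d * \<Lambda> powr (\<nu> * real d)"
      using elim(2) by (simp add: power_mult_distrib powr_powr[symmetric] powr_realpow \<Lambda>_def)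
    also have "2 * \<sigma> * \<Lambda> powr \<zeta> * (5 ^ d * \<Lambda> powr (\<nu> * real d)) = 2 * \<sigma> * 5 ^ d * \<Lambda> powr (\<nu> * real d + \<zeta>)"
      by (simp add: powr_add)
    also have "\<dots> \<le> ln (real n) / 4" using elim(1) unfolding \<Lambda>_def .
    finally have K: "- (ln (real n) / 4) \<le> - 2 * p * real ((2 * R n + 1) ^ d * n ^ d)" by simp
    have "real n powr (- 1 / 4) = exp (- (ln (real n) / 4))" using elim(6) by (simp add: powr_def)
    also have "\<dots> \<le> exp (- 2 * p * real ((2 * R n + 1) ^ d * n ^ d))" using K by simp
    finally have nK: "real n powr (- 1 / 4) \<le> exp (- 2 * p * real ((2 * R n + 1) ^ d * n ^ d))" .
    have mK: "(sqrt (real n) - 1) * real n powr (- 1 / 4) \<le>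
        real (m n) * exp (- 2 * p * real ((2 * R n + 1) ^ d * n ^ d))"
      using m(2) nK elim(3) by (intro mult_mono) auto
    have "measure_pmf.prob (newman_watts d \<alpha> \<beta> \<sigma> \<zeta> n) {E. graph_diam (torus_verts d n) E < R n} \<le>
        exp (- real (m n) * exp (- 2 * p * real ((2 * R n + 1) ^ d * n ^ d)))"
      using assms m mR elim(5) by (intro prob_diam_less_le) (auto simp: p_def)
    also have "\<dots> \<le> exp (- (sqrt (real n) - 1) * real n powr (- 1 / 4))"
      using mK unfolding exp_le_cancel_iff mult_minus_left neg_le_iff_le .
    finally have "1 - exp (- (sqrt (real n) - 1) * real n powr (- 1 / 4)) \<le>
        1 - measure_pmf.prob (newman_watts d \<alpha> \<beta> \<sigma> \<zeta> n) {E. graph_diam (torus_verts d n) E < R n}"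
      by simp
    also have "\<dots> = measure_pmf.prob (newman_watts d \<alpha> \<beta> \<sigma> \<zeta> n) (- {E. graph_diam (torus_verts d n) E < R n})"
      using measure_pmf.prob_compl[of "{E. graph_diam (torus_verts d n) E < R n}" "newman_watts d \<alpha> \<beta> \<sigma> \<zeta> n"]
      by (simp add: Compl_eq_Diff_UNIV)
    also have "\<dots> \<le> measure_pmf.prob (newman_watts d \<alpha> \<beta> \<sigma> \<zeta> n)
        {E. real (graph_diam (torus_verts d n) E) \<ge> ln (real n) powr \<nu>}"
      using R(1) unfolding \<Lambda>_def by (intro measure_pmf.finite_measure_mono) auto
    finally show ?case .
  qed
  show ?thesis
  proof (rule tendsto_sandwich[OF bound])
    show "\<forall>\<^sub>F n in sequentially. measure_pmf.prob (newman_watts d \<alpha> \<beta> \<sigma> \<zeta> n)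
        {E. real (graph_diam (torus_verts d n) E) \<ge> ln (real n) powr \<nu>} \<le> 1"
      by simp
    show "(\<lambda>n. 1 - exp (- (sqrt (real n) - 1) * real n powr (- 1 / 4))) \<longlonglongrightarrow> 1"
      by real_asymp
  qed simp
qed

section \<open>Expansion of the block graph\<close>

lemma card_circle_ball:
  assumes "a < n" "2 * t + 1 \<le> n"
  shows "card {b. b < n \<and> min \<bar>int a - int b\<bar> (int n - \<bar>int a - int b\<bar>) \<le> int t} = 2 * t + 1"
proof -
  \<comment> \<open>An interval around \<open>a\<close> cut off at both ends, and the two parts that
    wrap around. By truncated subtraction the interval starts at 0 when \<open>a < t\<close>; each
    wrapped part is empty when nothing wraps on its side. The bound \<open>2 * t + 1 \<le> n\<close>
    keeps the pieces disjoint.\<close>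
  have eq: "{b. b < n \<and> min \<bar>int a - int b\<bar> (int n - \<bar>int a - int b\<bar>) \<le> int t} =
      {a - t..min (n - 1) (a + t)} \<union> ({..<a + t + 1 - n} \<union> {a + n - t..<n})"
    using assms by (auto simp: min_le_iff_disj)
  have "{..<a + t + 1 - n} \<inter> {a + n - t..<n} = {}"
    and "{a - t..min (n - 1) (a + t)} \<inter> ({..<a + t + 1 - n} \<union> {a + n - t..<n}) = {}"
    using assms by auto
  then show ?thesis
    unfolding eq using assms by (simp add: card_Un_disjoint min_def) linarith
qed

text \<open>A maximum is at most \<open>t\<close> iff every coordinate is, so the ball is a product
  of \<open>d\<close> balls on a circle.\<close>

lemma card_torus_ball:
  assumes "d \<ge> 1" "u \<in> torus_verts d n" "2 * t + 1 \<le> n"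
  shows "card {v \<in> torus_verts d n. torus_dist d n u v \<le> int t} = (2 * t + 1) ^ d"
proof -
  have ne: "{..<d} \<noteq> {}" using assms(1) by (auto simp: lessThan_empty_iff)
  have "torus_dist d n u v \<le> int t \<longleftrightarrow>
      (\<forall>s<d. min \<bar>int (u s) - int (v s)\<bar> (int n - \<bar>int (u s) - int (v s)\<bar>) \<le> int t)" for v
    unfolding torus_dist_def using ne by (subst Max_le_iff) auto
  then have "{v \<in> torus_verts d n. torus_dist d n u v \<le> int t} =
      (\<Pi>\<^sub>E s\<in>{..<d}. {b. b < n \<and> min \<bar>int (u s) - int b\<bar> (int n - \<bar>int (u s) - int b\<bar>) \<le> int t})"
    unfolding torus_verts_def set_eq_iff mem_Collect_eq PiE_iff lessThan_iff by blast
  moreover have "card {b. b < n \<and> min \<bar>int (u s) - int b\<bar> (int n - \<bar>int (u s) - int b\<bar>) \<le> int t} = 2 * t + 1"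
    if "s \<in> {..<d}" for s
    using that assms(2,3) by (intro card_circle_ball) (auto dest: torus_verts_less)
  ultimately show ?thesis by (simp add: card_PiE)
qed

text \<open>The long neighbours contain the ball of radius floor(\<beta> n) minus the ball of radius
  floor(\<alpha> n). Rounding the radii accounts for the corrections by 1.\<close>

lemma card_long_neighbours:
  assumes "d \<ge> 1" "0 < \<alpha>" "\<alpha> < \<beta>" and n: "2 * \<beta> * real n + 1 \<le> real n" and u: "u \<in> torus_verts d n"
    and b: "1 \<le> 2 * \<beta> * real n"
  shows "(2 * \<beta> * real n - 1) ^ d - (2 * \<alpha> * real n + 1) ^ d \<le>
    real (card {v \<in> torus_verts d n. {u, v} \<in> long_pairs d \<alpha> \<beta> n})"
proof -
  define t where "t = (\<lambda>\<gamma>. nat \<lfloor>\<gamma> * real n\<rfloor>)"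
  let ?B = "\<lambda>t. {v \<in> torus_verts d n. torus_dist d n u v \<le> int t}"
  let ?N = "{v \<in> torus_verts d n. {u, v} \<in> long_pairs d \<alpha> \<beta> n}"
  have "\<alpha> * real n \<le> \<beta> * real n" using assms(3) by (intro mult_right_mono) auto
  moreover have nn: "0 \<le> \<alpha> * real n" using assms(2) by simp
  ultimately have t: "real (t \<beta>) \<le> \<beta> * real n" "\<beta> * real n - 1 \<le> real (t \<beta>)"
    "real (t \<alpha>) \<le> \<alpha> * real n" "\<alpha> * real n < real (t \<alpha>) + 1" "t \<alpha> \<le> t \<beta>"
    unfolding t_def by (linarith | intro nat_mono floor_mono)+
  have "real (2 * t \<beta> + 1) \<le> real n" using t(1) n by simp
  then have \<beta>n: "2 * t \<beta> + 1 \<le> n" unfolding of_nat_le_iff .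
  have \<alpha>n: "2 * t \<alpha> + 1 \<le> n" using \<beta>n t(5) by simp
  have sub: "?B (t \<beta>) \<subseteq> ?N \<union> ?B (t \<alpha>)"
  proof
    fix v assume v: "v \<in> ?B (t \<beta>)"
    show "v \<in> ?N \<union> ?B (t \<alpha>)"
    proof (cases "torus_dist d n u v \<le> int (t \<alpha>)")
      case False
      have "torus_dist d n u u \<le> 0" by (rule torus_dist_le[OF assms(1)]) simp
      then have "u \<noteq> v" using False by auto
      moreover have "\<alpha> * real n \<le> real_of_int (torus_dist d n u v)" using False t(4) by linarith
      moreover have "torus_dist d n u v \<le> int (t \<beta>)" using v by simp
      then have "real_of_int (torus_dist d n u v) \<le> \<beta> * real n" using t(1) by linarith
      ultimately have "{u, v} \<in> long_pairs d \<alpha> \<beta> n"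
        unfolding long_pairs_def using u v by (intro CollectI exI conjI refl) auto
      then show ?thesis using v by simp
    qed (use v in simp)
  qed
  have "card (?B (t \<beta>)) \<le> card (?N \<union> ?B (t \<alpha>))"
    using finite_torus_verts by (intro card_mono sub) auto
  also have "\<dots> \<le> card ?N + card (?B (t \<alpha>))" by (rule card_Un_le)
  finally have "(2 * t \<beta> + 1) ^ d \<le> card ?N + (2 * t \<alpha> + 1) ^ d"
    unfolding card_torus_ball[OF assms(1) u \<alpha>n] card_torus_ball[OF assms(1) u \<beta>n] .
  then have "real ((2 * t \<beta> + 1) ^ d) \<le> real (card ?N + (2 * t \<alpha> + 1) ^ d)"
    unfolding of_nat_le_iff .
  then have le: "(2 * real (t \<beta>) + 1) ^ d \<le> real (card ?N) + (2 * real (t \<alpha>) + 1) ^ d"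
    by (simp add: algebra_simps)
  have "(2 * \<beta> * real n - 1) ^ d \<le> (2 * real (t \<beta>) + 1) ^ d"
    using t(2) b by (intro power_mono) linarith+
  moreover have "(2 * real (t \<alpha>) + 1) ^ d \<le> (2 * \<alpha> * real n + 1) ^ d"
    using t(3) by (intro power_mono) linarith+
  ultimately show ?thesis using le by linarith
qed

section \<open>Blocks and the long pairs between them\<close>

text \<open>Blocks are indexed by points \<open>j\<close> of the coarser grid
  \<open>torus_verts d m\<close>, so its counting lemmas apply to families of blocks. If
  \<open>m * L < n\<close>, a margin stays uncovered.\<close>

definition block :: "nat \<Rightarrow> nat \<Rightarrow> (nat \<Rightarrow> nat) \<Rightarrow> (nat \<Rightarrow> nat) set" where
  "block d L j = cube d (\<lambda>s. L * j s) L"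

definition blocks :: "nat \<Rightarrow> nat \<Rightarrow> (nat \<Rightarrow> nat) set \<Rightarrow> (nat \<Rightarrow> nat) set" where
  "blocks d L S = (\<Union>j\<in>S. block d L j)"

lemma block_div: "x \<in> block d L j \<Longrightarrow> s < d \<Longrightarrow> x s div L = j s"
  unfolding block_def cube_def by (intro div_nat_eqI) (auto simp: PiE_iff algebra_simps)

lemma block_unique:
  assumes "x \<in> block d L j" "x \<in> block d L k" "j \<in> torus_verts d m" "k \<in> torus_verts d m"
  shows "j = k"
  using assms(3,4) by (rule torus_verts_eqI) (use block_div[OF assms(1)] block_div[OF assms(2)] in auto)

lemma finite_blocks: "finite S \<Longrightarrow> finite (blocks d L S)"
  unfolding blocks_def block_def using finite_cube by auto

lemma card_blocks:
  assumes "S \<subseteq> torus_verts d m"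
  shows "card (blocks d L S) = card S * L ^ d"
proof -
  have "finite S" using assms finite_torus_verts finite_subset by blast
  then have "card (blocks d L S) = (\<Sum>j\<in>S. card (block d L j))"
    unfolding blocks_def
  proof (rule card_UN_disjoint)
    show "\<forall>j\<in>S. finite (block d L j)" by (simp add: block_def finite_cube)
    show "\<forall>j\<in>S. \<forall>k\<in>S. j \<noteq> k \<longrightarrow> block d L j \<inter> block d L k = {}"
    proof (intro ballI impI, rule ccontr)
      fix j k assume jk: "j \<in> S" "k \<in> S" "j \<noteq> k" "block d L j \<inter> block d L k \<noteq> {}"
      then obtain x where "x \<in> block d L j" "x \<in> block d L k" by blast
      then show False using block_unique[of x d L j k m] jk assms by blast
    qed
  qed
  then show ?thesis by (simp add: block_def card_cube)
qed

lemma blocks_disjoint: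
  assumes "S \<subseteq> torus_verts d m" "T \<subseteq> torus_verts d m" "S \<inter> T = {}"
  shows "blocks d L S \<inter> blocks d L T = {}"
proof (rule ccontr)
  assume "blocks d L S \<inter> blocks d L T \<noteq> {}"
  then obtain x j k where x: "j \<in> S" "k \<in> T" "x \<in> block d L j" "x \<in> block d L k"
    unfolding blocks_def by blast
  then have "j = k" using block_unique[of x d L j k m] assms(1,2) by blast
  then show False using x(1,2) assms(3) by blast
qed

lemma block_subset_torus:
  assumes "m * L \<le> n" "j \<in> torus_verts d m"
  shows "block d L j \<subseteq> torus_verts d n"
  unfolding block_def
proof (rule cube_subset_torus)
  fix s assume "s < d"
  then have "Suc (j s) \<le> m" using torus_verts_less[OF assms(2)] by (simp add: Suc_leI)
  then have "Suc (j s) * L \<le> m * L" by (rule mult_le_mono1)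
  then show "L * j s + L \<le> n" using assms(1) by (simp add: algebra_simps)
qed

lemma blocks_subset_torus:
  "m * L \<le> n \<Longrightarrow> S \<subseteq> torus_verts d m \<Longrightarrow> blocks d L S \<subseteq> torus_verts d n"
  unfolding blocks_def using block_subset_torus by blast

text \<open>Of the at least \<delta> partners of a vertex, those missed by the blocks outside
  \<open>W\<close> lie in \<open>W\<close> or in the uncovered margin. So at least \<open>h\<close>
  partners remain for each of the \<open>card S * L ^ d\<close> vertices in blocks of
  \<open>S\<close>.\<close>

lemma card_pairs_between_blocks:
  assumes mL: "m * L \<le> n" and SW: "S \<subseteq> W" "W \<subseteq> torus_verts d m"
    and deg: "\<And>u. u \<in> torus_verts d n \<Longrightarrow> \<delta> \<le> real (card {v \<in> torus_verts d n. {u, v} \<in> P})"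
    and h: "h \<le> \<delta> - real (n ^ d) + real (m ^ d * L ^ d) - real (card W * L ^ d)"
    and P: "finite P"
  shows "real (card S * L ^ d) * h \<le> real (card {e \<in> P. \<exists>u v. e = {u, v} \<and> u \<in> blocks d L S \<and> v \<in> blocks d L (torus_verts d m - W)})"
proof -
  define J where "J = torus_verts d m"
  define V where "V = torus_verts d n"
  define T where "T = blocks d L (J - W)"
  have finJ: "finite J" "finite S" "finite W"
    using finite_torus_verts finite_subset[OF SW(2) finite_torus_verts] finite_subset[OF SW(1)]
    unfolding J_def by auto
  have SJ: "S \<subseteq> J" "W \<subseteq> J" using SW unfolding J_def by auto
  have TV: "T \<subseteq> V" unfolding T_def V_def J_def by (rule blocks_subset_torus[OF mL]) auto
  have finV: "finite V" unfolding V_def by (rule finite_torus_verts)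
  have finT: "finite T" using TV finV finite_subset by blast
  have cT: "card T = (m ^ d - card W) * L ^ d"
    unfolding T_def using card_blocks[of "J - W" d m L] card_Diff_subset[OF finJ(3) SJ(2)]
    by (simp add: J_def card_torus_verts)
  have cW: "card W \<le> m ^ d"
    using card_mono[OF finJ(1) SJ(2)] by (simp add: J_def card_torus_verts)
  have nbr: "h \<le> real (card {v \<in> T. {u, v} \<in> P})" if "u \<in> V" for u
  proof -
    have "{v \<in> V. {u, v} \<in> P} \<subseteq> {v \<in> T. {u, v} \<in> P} \<union> (V - T)" by auto
    then have "card {v \<in> V. {u, v} \<in> P} \<le> card ({v \<in> T. {u, v} \<in> P} \<union> (V - T))"
      using finT finV by (intro card_mono) auto
    also have "\<dots> \<le> card {v \<in> T. {u, v} \<in> P} + card (V - T)" by (rule card_Un_le)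
    also have "card (V - T) = card V - card T" using card_Diff_subset[OF finT TV] .
    finally have "real (card {v \<in> V. {u, v} \<in> P}) \<le> real (card {v \<in> T. {u, v} \<in> P}) + real (card V) - real (card T)"
      using card_mono[OF finV TV] by linarith
    moreover have "real (card V) = real (n ^ d)" by (simp add: V_def card_torus_verts)
    moreover have "real (card T) = real (m ^ d * L ^ d) - real (card W * L ^ d)"
      unfolding cT using cW by (simp add: of_nat_diff algebra_simps)
    ultimately show ?thesis using deg[of u] that h unfolding V_def by linarith
  qed
  define X where "X = (SIGMA u:blocks d L S. {v \<in> T. {u, v} \<in> P})"
  have SV: "blocks d L S \<subseteq> V"
    unfolding V_def using SJ(1) unfolding J_def by (intro blocks_subset_torus[OF mL])
  have disj: "blocks d L S \<inter> T = {}"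
    unfolding T_def using SJ SW(1) unfolding J_def by (intro blocks_disjoint) auto
  \<comment> \<open>No unordered pair is counted twice, since its two ends lie in disjoint
    sets.\<close>
  have inj: "inj_on (\<lambda>(u, v). {u, v}) X"
  proof (rule inj_onI, clarify)
    fix u v u' v' assume "(u, v) \<in> X" "(u', v') \<in> X" and eq: "{u, v} = {u', v'}"
    then have "u \<in> blocks d L S" "v \<in> T" "u' \<in> blocks d L S" "v' \<in> T" unfolding X_def by auto
    then have "u \<noteq> v'" "v \<noteq> u'" using disj by auto
    then show "u = u' \<and> v = v'" using eq by (simp add: doubleton_eq_iff)
  qed
  have "real (card S * L ^ d) * h = (\<Sum>u\<in>blocks d L S. h)"
    using card_blocks[of S d m L] SJ(1) unfolding J_def by simp
  also have "\<dots> \<le> (\<Sum>u\<in>blocks d L S. real (card {v \<in> T. {u, v} \<in> P}))"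
    using nbr SV by (intro sum_mono) auto
  also have "\<dots> = real (card X)"
    unfolding X_def using finT finite_blocks[OF finJ(2)] by (subst card_SigmaI) auto
  also have "card X = card ((\<lambda>(u, v). {u, v}) ` X)" using card_image[OF inj] by simp
  also have "\<dots> \<le> card {e \<in> P. \<exists>u v. e = {u, v} \<and> u \<in> blocks d L S \<and> v \<in> T}"
  proof (intro card_mono)
    show "finite {e \<in> P. \<exists>u v. e = {u, v} \<and> u \<in> blocks d L S \<and> v \<in> T}" using P by simp
    show "(\<lambda>(u, v). {u, v}) ` X \<subseteq> {e \<in> P. \<exists>u v. e = {u, v} \<and> u \<in> blocks d L S \<and> v \<in> T}"
    proof
      fix e assume "e \<in> (\<lambda>(u, v). {u, v}) ` X"
      then obtain u v where "e = {u, v}" "u \<in> blocks d L S" "v \<in> T" "{u, v} \<in> P"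
        unfolding X_def by (elim imageE SigmaE) auto
      then show "e \<in> {e \<in> P. \<exists>u v. e = {u, v} \<and> u \<in> blocks d L S \<and> v \<in> T}" by blast
    qed
  qed
  finally show ?thesis unfolding T_def J_def by simp
qed

section \<open>Union bound for the expansion property\<close>

text \<open>Sets are encoded by lists of prescribed length, padded by repeating an element, so that
  the union bound counts lists by powers instead of binomial coefficients.\<close>

lemma list_of_length_with_set:
  assumes "finite A" "A \<noteq> {}" "card A \<le> k"
  obtains xs where "set xs = A" "length xs = k"
proof -
  obtain ys where ys: "set ys = A" "distinct ys" using finite_distinct_list[OF assms(1)] by auto
  then have "length ys \<le> k" "ys \<noteq> []" using assms distinct_card[of ys] by auto
  moreover from this have "set (ys @ replicate (k - length ys) (hd ys)) = A"
    using ys(1) by (auto split: if_splits)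
  ultimately show ?thesis using that[of "ys @ replicate (k - length ys) (hd ys)"] by simp
qed

text \<open>
  In the graph of blocks, a set \<open>S\<close> of at most half of the blocks together with its neighbours has
  more than \<open>(1 + \<eta>) |S|\<close> elements: otherwise that union would be a set \<open>W\<close> violating the condition.
\<close>

definition expands :: "nat \<Rightarrow> nat \<Rightarrow> nat \<Rightarrow> real \<Rightarrow> (nat \<Rightarrow> nat) set set \<Rightarrow> bool" where
  "expands d m L \<eta> F \<longleftrightarrow> (\<forall>S W. S \<subseteq> W \<and> W \<subseteq> torus_verts d m \<and> S \<noteq> {} \<and>
     2 * card S \<le> m ^ d \<and> real (card W) \<le> (1 + \<eta>) * real (card S) \<longrightarrow>
     (\<exists>u v. {u, v} \<in> F \<and> u \<in> blocks d L S \<and> v \<in> blocks d L (torus_verts d m - W)))"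

text \<open>Encode a violating pair with \<open>card S = k\<close> by lists of lengths
  \<open>k\<close> and \<open>2 * k\<close>: there are \<open>(m ^ (3 * d)) ^ k\<close> of them.
  Each requires at least \<open>k * L ^ d * \<eta> * n ^ d\<close> absent pairs, so size
  \<open>k\<close> contributes at most \<open>y ^ k \<le> y\<close>, and there are at most
  \<open>m ^ d\<close> sizes.\<close>

lemma prob_not_expands_le:
  assumes mL: "m * L \<le> n" and \<eta>: "0 < \<eta>" "\<eta> \<le> 1" and p: "0 \<le> p" "p \<le> 1" and P: "finite P"
    and deg: "\<And>u. u \<in> torus_verts d n \<Longrightarrow>
      (1 / 2 + 3 * \<eta>) * real n ^ d \<le> real (card {v \<in> torus_verts d n. {u, v} \<in> P})"
    and cover: "(1 - \<eta>) * real n ^ d \<le> real (m * L) ^ d"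
    and y: "y = real m ^ (3 * d) * exp (- p * real L ^ d * \<eta> * real n ^ d)" "y \<le> 1"
  shows "measure_pmf.prob (Pi_pmf P False (\<lambda>_. bernoulli_pmf p)) {f. \<not> expands d m L \<eta> {e \<in> P. f e}} \<le> real m ^ d * y"
proof -
  define J where "J = torus_verts d m"
  define Q where "Q = Pi_pmf P False (\<lambda>_. bernoulli_pmf p)"
  define x where "x = exp (- p * real L ^ d * \<eta> * real n ^ d)"
  have finJ: "finite J" unfolding J_def by (rule finite_torus_verts)
  have cJ: "card J = m ^ d" unfolding J_def by (rule card_torus_verts)
  define A where "A = (\<lambda>S W. {e \<in> P. \<exists>u v. e = {u, v} \<and> u \<in> blocks d L S \<and> v \<in> blocks d L (J - W)})"
  define ok where "ok = (\<lambda>k S W. S \<subseteq> W \<and> W \<subseteq> J \<and> card S = k \<and> 2 * k \<le> m ^ d \<and> real (card W) \<le> (1 + \<eta>) * real k)"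
  \<comment> \<open>With \<open>ok\<close> inside the event, lists that encode no admissible pair
    give the empty event and need no separate treatment.\<close>
  define B where "B = (\<lambda>k (xs, ws). {f. ok k (set xs) (set ws) \<and> (\<forall>e\<in>A (set xs) (set ws). \<not> f e)})"
  define I where "I = (\<lambda>k. {xs. set xs \<subseteq> J \<and> length xs = k} \<times> {ws. set ws \<subseteq> J \<and> length ws = 2 * k})"
  have finI: "finite (I k)" for k unfolding I_def using finJ by (simp add: finite_lists_length_eq)
  have cI: "real (card (I k)) = (real m ^ (3 * d)) ^ k" for k
  proof -
    have "card (I k) = (m ^ d) ^ k * (m ^ d) ^ (2 * k)"
      unfolding I_def card_cartesian_product using finJ by (simp add: card_lists_length_eq cJ)
    also have "\<dots> = (m ^ (3 * d)) ^ k"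
      by (simp add: power_mult[symmetric] power_add[symmetric] algebra_simps)
    finally show ?thesis by simp
  qed
  have one: "measure_pmf.prob Q (B k z) \<le> x ^ k" for k z
  proof (cases z)
    case (Pair xs ws)
    let ?S = "set xs" and ?W = "set ws"
    show ?thesis
    proof (cases "ok k ?S ?W")
      case False
      then have "B k z = {}" unfolding B_def Pair by simp
      then show ?thesis by (simp add: x_def)
    next
      case True
      then have ok: "?S \<subseteq> ?W" "?W \<subseteq> J" "card ?S = k" "2 * k \<le> m ^ d" "real (card ?W) \<le> (1 + \<eta>) * real k"
        unfolding ok_def by auto
      \<comment> \<open>Budget in units of \<open>n ^ d\<close>: the degree is 1/2 + 3\<eta>, the
        margin costs at most \<eta>, and \<open>W\<close> at most (1 + \<eta>)/2 because
        \<open>S\<close> is at most half of the blocks. This leaves 3\<eta>/2 \<ge> \<eta>.\<close>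
      have h: "real (k * L ^ d) * (\<eta> * real n ^ d) \<le> real (card (A ?S ?W))"
        unfolding A_def ok(3)[symmetric] J_def
      proof (rule card_pairs_between_blocks[OF mL ok(1) ok(2)[unfolded J_def] deg _ P])
        have "2 * real k \<le> real m ^ d" using ok(4) by (metis of_nat_le_iff of_nat_mult of_nat_numeral of_nat_power)
        then have "2 * real k * real L ^ d \<le> real m ^ d * real L ^ d" by (intro mult_right_mono) auto
        also have "\<dots> = real (m * L) ^ d" by (simp add: power_mult_distrib)
        also have "\<dots> \<le> real n ^ d" using mL by (intro power_mono of_nat_mono) auto
        finally have "2 * (real k * real L ^ d) \<le> real n ^ d" by simp
        then have "(1 + \<eta>) * (2 * (real k * real L ^ d)) \<le> (1 + \<eta>) * real n ^ d"
          using \<eta> by (intro mult_left_mono) auto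
        moreover have "real (card ?W * L ^ d) \<le> (1 + \<eta>) * real k * real L ^ d"
          using mult_right_mono[OF ok(5), of "real L ^ d"] by simp
        ultimately have "2 * real (card ?W * L ^ d) \<le> (1 + \<eta>) * real n ^ d" by (simp add: algebra_simps)
        moreover have "0 \<le> \<eta> * real n ^ d" using \<eta> by simp
        ultimately show "\<eta> * real n ^ d \<le> (1 / 2 + 3 * \<eta>) * real n ^ d - real (n ^ d) + real (m ^ d * L ^ d) -
            real (card ?W * L ^ d)"
          using cover by (simp add: algebra_simps power_mult_distrib)
      qed
      have "measure_pmf.prob Q (B k z) \<le> measure_pmf.prob Q {f. \<forall>e\<in>A ?S ?W. \<not> f e}"
        unfolding B_def Pair by (intro measure_pmf.finite_measure_mono) auto
      also have "\<dots> = (1 - p) ^ card (A ?S ?W)"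
        unfolding Q_def using P p by (intro prob_all_absent) (auto simp: A_def)
      also have "\<dots> \<le> exp (- p) ^ card (A ?S ?W)"
        using p exp_ge_add_one_self[of "- p"] by (intro power_mono) auto
      also have "\<dots> = exp (- (p * real (card (A ?S ?W))))"
        by (simp add: exp_of_nat2_mult[symmetric])
      also have "\<dots> \<le> exp (- (p * (real (k * L ^ d) * (\<eta> * real n ^ d))))"
        using mult_left_mono[OF h p(1)] by simp
      also have "\<dots> = x ^ k"
        unfolding x_def by (simp add: exp_of_nat_mult[symmetric] algebra_simps)
      finally show ?thesis .
    qed
  qed
  have sub: "{f. \<not> expands d m L \<eta> {e \<in> P. f e}} \<subseteq> (\<Union>k\<in>{1..m ^ d}. \<Union>z\<in>I k. B k z)"
  proof
    fix f assume "f \<in> {f. \<not> expands d m L \<eta> {e \<in> P. f e}}"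
    then obtain S W where SW: "S \<subseteq> W" "W \<subseteq> J" "S \<noteq> {}" "2 * card S \<le> m ^ d"
        "real (card W) \<le> (1 + \<eta>) * real (card S)"
      and no: "\<not> (\<exists>u v. {u, v} \<in> {e \<in> P. f e} \<and> u \<in> blocks d L S \<and> v \<in> blocks d L (J - W))"
      unfolding expands_def J_def by auto
    have fin: "finite W" using finite_subset[OF SW(2) finJ] .
    have finS: "finite S" using finite_subset[OF SW(1) fin] .
    have k0: "card S \<noteq> 0" using finS SW(3) by simp
    \<comment> \<open>Here \<eta> \<le> 1 makes length \<open>2 * k\<close> sufficient for listing
      \<open>W\<close>.\<close>
    have "(1 + \<eta>) * real (card S) \<le> 2 * real (card S)" using \<eta> by (intro mult_right_mono) auto
    then have "card W \<le> 2 * card S" using SW(5) by linarith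
    then obtain ws where ws: "set ws = W" "length ws = 2 * card S"
      using list_of_length_with_set[OF fin] SW(1,3) by auto
    obtain xs where xs: "set xs = S" "length xs = card S"
      using list_of_length_with_set[OF finS SW(3)] by blast
    have "f \<in> B (card S) (xs, ws)"
      unfolding B_def ok_def using SW xs ws no unfolding A_def by auto
    moreover have "(xs, ws) \<in> I (card S)" unfolding I_def using SW xs ws by auto
    moreover have "card S \<in> {1..m ^ d}" using k0 SW(4) by auto
    ultimately show "f \<in> (\<Union>k\<in>{1..m ^ d}. \<Union>z\<in>I k. B k z)" by blast
  qed
  have "measure_pmf.prob Q {f. \<not> expands d m L \<eta> {e \<in> P. f e}} \<le>
      measure_pmf.prob Q (\<Union>k\<in>{1..m ^ d}. \<Union>z\<in>I k. B k z)"
    by (intro measure_pmf.finite_measure_mono sub) auto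
  also have "\<dots> \<le> (\<Sum>k\<in>{1..m ^ d}. measure_pmf.prob Q (\<Union>z\<in>I k. B k z))"
    by (intro measure_pmf.finite_measure_subadditive_finite) auto
  also have "\<dots> \<le> (\<Sum>k\<in>{1..m ^ d}. y)"
  proof (rule sum_mono)
    fix k assume k: "k \<in> {1..m ^ d}"
    have "measure_pmf.prob Q (\<Union>z\<in>I k. B k z) \<le> (\<Sum>z\<in>I k. measure_pmf.prob Q (B k z))"
      using finI by (intro measure_pmf.finite_measure_subadditive_finite) auto
    also have "\<dots> \<le> (\<Sum>z\<in>I k. x ^ k)" by (intro sum_mono one)
    also have "\<dots> = y ^ k" by (simp add: cI y(1) x_def power_mult_distrib)
    also have "\<dots> \<le> y ^ 1" using k y by (intro power_decreasing) auto
    finally show "measure_pmf.prob Q (\<Union>z\<in>I k. B k z) \<le> y" by simp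
  qed
  also have "\<dots> = real m ^ d * y" by simp
  finally show ?thesis unfolding Q_def .
qed

section \<open>From expansion to a bound on the diameter\<close>

text \<open>A ball grows by the factor 1 + \<eta> per step until it exceeds half of
  \<open>J\<close>. After \<open>r\<close> steps both balls exceed half, so they intersect.\<close>

lemma expander_balls_meet:
  fixes A :: "('j \<times> 'j) set" and \<eta> :: real
  assumes "finite J" "A \<subseteq> J \<times> J" "\<eta> > 0"
    and exp: "\<And>S. S \<subseteq> J \<Longrightarrow> S \<noteq> {} \<Longrightarrow> 2 * card S \<le> card J \<Longrightarrow>
      (1 + \<eta>) * real (card S) \<le> real (card (S \<union> A `` S))"
    and r: "real (card J) \<le> (1 + \<eta>) ^ r" and ij: "i \<in> J" "j \<in> J"
  shows "\<exists>k. (i, k) \<in> (A \<union> Id) ^^ r \<and> (j, k) \<in> (A \<union> Id) ^^ r"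
proof -
  define b where "b = (\<lambda>i r. ((A \<union> Id) ^^ r) `` {i})"
  have b_Suc: "b i (Suc r) = b i r \<union> A `` b i r" for i r unfolding b_def by auto
  have bJ: "b i r \<subseteq> J" if "i \<in> J" for i r
  proof (induction r)
    case 0
    then show ?case using that by (simp add: b_def)
  next
    case (Suc r)
    then show ?case using assms(2) unfolding b_Suc by auto
  qed
  \<comment> \<open>A disjunction, because growth is guaranteed only up to half; once passed, half
    stays passed as balls increase with the radius.\<close>
  have grow: "card J < 2 * card (b i r) \<or> (1 + \<eta>) ^ r \<le> real (card (b i r))" if "i \<in> J" for i r
  proof (induction r)
    case 0
    then show ?case by (simp add: b_def)
  next
    case (Suc r)
    have fin: "finite (b i (Suc r))" using bJ[OF that] assms(1) finite_subset by blast
    have le: "card (b i r) \<le> card (b i (Suc r))" using fin by (intro card_mono) (auto simp: b_Suc)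
    have ne: "b i r \<noteq> {}" by (induction r) (auto simp: b_def b_Suc)
    show ?case
    proof (cases "card J < 2 * card (b i r)")
      case True
      then show ?thesis using le by linarith
    next
      case False
      then have "(1 + \<eta>) * (1 + \<eta>) ^ r \<le> (1 + \<eta>) * real (card (b i r))"
        using Suc assms(3) by (intro mult_left_mono) auto
      also have "\<dots> \<le> real (card (b i (Suc r)))"
        unfolding b_Suc using False by (intro exp bJ that ne) auto
      finally show ?thesis by simp
    qed
  qed
  have half: "card J < 2 * card (b i r)" if "i \<in> J" for i
  proof -
    have "card J > 0" using that assms(1) card_gt_0_iff by blast
    then show ?thesis using grow[OF that, of r] r by linarith
  qed
  have "b i r \<inter> b j r \<noteq> {}"
  proof
    assume "b i r \<inter> b j r = {}"
    then have "card (b i r) + card (b j r) = card (b i r \<union> b j r)"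
      using finite_subset[OF bJ assms(1)] ij by (subst card_Un_disjoint) auto
    also have "\<dots> \<le> card J" using bJ ij assms(1) by (intro card_mono) auto
    finally show False using half[OF ij(1)] half[OF ij(2)] by linarith
  qed
  then show ?thesis unfolding b_def by auto
qed

lemma near_in_box:
  assumes "x \<in> torus_verts d n" "y \<in> torus_verts d n" "torus_edges d n \<subseteq> E"
    and "\<And>s. s < d \<Longrightarrow> \<bar>int (x s) - int (y s)\<bar> \<le> int L"
  shows "(x, y) \<in> near (torus_verts d n) E (d * L)"
proof (rule near_mono[OF near_torus[OF assms(1-3)]])
  have "(\<Sum>s<d. nat \<bar>int (x s) - int (y s)\<bar>) \<le> (\<Sum>s<d. L)"
    using assms(4) by (intro sum_mono) (auto simp: nat_le_iff)
  then show "(\<Sum>s<d. nat \<bar>int (x s) - int (y s)\<bar>) \<le> d * L" by simp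
qed

lemma near_in_block:
  assumes "m * L \<le> n" "j \<in> torus_verts d m" "torus_edges d n \<subseteq> E" "x \<in> block d L j" "y \<in> block d L j"
  shows "(x, y) \<in> near (torus_verts d n) E (d * L)"
proof (rule near_in_box[OF _ _ assms(3)])
  show "x \<in> torus_verts d n" "y \<in> torus_verts d n"
    using block_subset_torus[OF assms(1,2)] assms(4,5) by auto
  fix s assume s: "s < d"
  have "x s \<in> {L * j s..<L * j s + L}" "y s \<in> {L * j s..<L * j s + L}"
    using PiE_mem[OF assms(4)[unfolded block_def cube_def]]
      PiE_mem[OF assms(5)[unfolded block_def cube_def]] s by blast+
  then show "\<bar>int (x s) - int (y s)\<bar> \<le> int L" by auto
qed

text \<open>The margin is thinner than \<open>L\<close>: lowering every coordinate to at most
  \<open>m * L - 1\<close> reaches a block and moves each coordinate by at most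
  \<open>L\<close>.\<close>

lemma near_block:
  assumes "m * L \<le> n" "n < m * L + L" "m \<ge> 1" "torus_edges d n \<subseteq> E" "x \<in> torus_verts d n"
  shows "\<exists>j\<in>torus_verts d m. \<exists>y\<in>block d L j. (x, y) \<in> near (torus_verts d n) E (d * L)"
proof -
  define y where "y = restrict (\<lambda>s. min (x s) (m * L - 1)) {..<d}"
  define j where "j = restrict (\<lambda>s. y s div L) {..<d}"
  have L: "L > 0" using assms(1,2) by (cases L) auto
  have mL: "m * L > 0" using L assms(3) by simp
  have y_lt: "y s < m * L" if "s < d" for s
  proof -
    have "y s \<le> m * L - 1" using that unfolding y_def by simp
    then show ?thesis using mL by linarith
  qed
  have "y s div L < m" if "s < d" for s using y_lt[OF that] L by (simp add: less_mult_imp_div_less)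
  then have jJ: "j \<in> torus_verts d m" unfolding torus_verts_def j_def restrict_PiE_iff by simp
  have yV: "y \<in> torus_verts d n" unfolding torus_verts_def y_def restrict_PiE_iff
  proof
    fix s assume "s \<in> {..<d}"
    then show "min (x s) (m * L - 1) \<in> {..<n}" using torus_verts_less[OF assms(5), of s] by auto
  qed
  have yj: "y \<in> block d L j" unfolding block_def cube_def
  proof (rule PiE_I)
    fix s assume s: "s \<in> {..<d}"
    have "L * (y s div L) \<le> y s" by simp
    moreover have "y s < L * (y s div L) + L" using L by (metis add.commute dividend_less_times_div)
    ultimately show "y s \<in> {L * j s..<L * j s + L}" using s by (simp add: j_def)
  next
    fix s assume "s \<notin> {..<d}"
    then show "y s = undefined" by (simp add: y_def)
  qed
  have "(x, y) \<in> near (torus_verts d n) E (d * L)"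
  proof (rule near_in_box[OF assms(5) yV assms(4)])
    fix s assume s: "s < d"
    then have "x s < n" using torus_verts_less[OF assms(5)] by simp
    moreover have "y s = min (x s) (m * L - 1)" using s unfolding y_def by simp
    ultimately have "y s \<le> x s" "x s \<le> y s + L" using assms(2) mL by linarith+
    then show "\<bar>int (x s) - int (y s)\<bar> \<le> int L" by linarith
  qed
  then show ?thesis using jJ yj by blast
qed

text \<open>Entering a block costs \<open>d * L\<close> edges. Each step in the block graph costs
  one edge plus \<open>d * L\<close> to cross the block reached, and the first block costs another
  \<open>d * L\<close>. Both ends do this for \<open>r\<close> steps, up to a common block.\<close>

lemma graph_diam_le_of_expands:
  assumes n: "m * L \<le> n" "n < m * L + L" "m \<ge> 1" and \<eta>: "\<eta> > 0"
    and F: "expands d m L \<eta> F" and r: "real m ^ d \<le> (1 + \<eta>) ^ r"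
  shows "graph_diam (torus_verts d n) (torus_edges d n \<union> F) \<le> 2 * (r * (d * L + 1)) + 4 * (d * L)"
proof -
  define J where "J = torus_verts d m"
  define V where "V = torus_verts d n"
  define E where "E = torus_edges d n \<union> F"
  define A where "A = {(j, k). j \<in> J \<and> k \<in> J \<and> (\<exists>u\<in>block d L j. \<exists>v\<in>block d L k. {u, v} \<in> E)}"
  have tE: "torus_edges d n \<subseteq> E" unfolding E_def by simp
  have cJ: "card J = m ^ d" unfolding J_def by (rule card_torus_verts)
  have in_block: "(x, y) \<in> near V E (d * L)" if "j \<in> J" "x \<in> block d L j" "y \<in> block d L j" for j x y
    unfolding V_def using near_in_block[OF n(1) _ tE that(2,3)] that(1) unfolding J_def by simp
  have meet: "\<exists>k. (i, k) \<in> (A \<union> Id) ^^ r \<and> (j, k) \<in> (A \<union> Id) ^^ r" if "i \<in> J" "j \<in> J" for i j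
  proof (rule expander_balls_meet[OF _ _ \<eta> _ _ that])
    show "finite J" unfolding J_def by (rule finite_torus_verts)
    show "A \<subseteq> J \<times> J" unfolding A_def by auto
    show "real (card J) \<le> (1 + \<eta>) ^ r" using r by (simp add: cJ)
    fix S assume S: "S \<subseteq> J" "S \<noteq> {}" "2 * card S \<le> card J"
    show "(1 + \<eta>) * real (card S) \<le> real (card (S \<union> A `` S))"
    proof (rule ccontr)
      \<comment> \<open>If the neighbourhood were too small, it could be taken as \<open>W\<close>;
        \<open>expands\<close> would then give an edge from \<open>S\<close> to a block outside
        \<open>W\<close>, which is a neighbour of \<open>S\<close> after all.\<close>
      assume less: "\<not> (1 + \<eta>) * real (card S) \<le> real (card (S \<union> A `` S))"
      have WJ: "S \<union> A `` S \<subseteq> J" using S(1) unfolding A_def by auto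
      obtain u v where uv: "{u, v} \<in> F" "u \<in> blocks d L S" "v \<in> blocks d L (J - (S \<union> A `` S))"
        using F[unfolded expands_def, rule_format, of S "S \<union> A `` S"] S WJ less cJ
        unfolding J_def by auto
      then obtain j k where "j \<in> S" "u \<in> block d L j" "k \<in> J" "k \<notin> A `` S" "v \<in> block d L k"
        unfolding blocks_def by auto
      moreover have "{u, v} \<in> E" using uv(1) unfolding E_def by simp
      ultimately show False using S(1) unfolding A_def by blast
    qed
  qed
  have reach: "(x, y) \<in> near V E (t * (d * L + 1) + d * L)"
    if "(i, k) \<in> (A \<union> Id) ^^ t" "i \<in> J" "x \<in> block d L i" "y \<in> block d L k" for i k x y t
    using that(1,4)
  proof (induction t arbitrary: k y)
    case 0
    then show ?case using in_block[OF that(2,3)] by simp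
  next
    case (Suc t)
    then obtain l where l: "(i, l) \<in> (A \<union> Id) ^^ t" "l = k \<or> (l, k) \<in> A" by auto
    show ?case
    proof (cases "l = k")
      case True
      then show ?thesis using Suc.IH[of l y] l(1) Suc.prems(2) by (auto intro: near_mono)
    next
      case False
      then obtain u v where uv: "k \<in> J" "u \<in> block d L l" "v \<in> block d L k" "{u, v} \<in> E" "l \<in> J"
        using l(2) unfolding A_def by auto
      have "u \<in> V" "v \<in> V" using uv block_subset_torus[OF n(1)] unfolding V_def J_def by auto
      then have "(u, v) \<in> near V E 1" using near_edge uv(4) by auto
      then have "(x, y) \<in> near V E (t * (d * L + 1) + d * L + 1 + d * L)"
        by (rule near_trans[OF near_trans[OF Suc.IH[OF l(1) uv(2)]] in_block[OF uv(1,3) Suc.prems(2)]])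
      then show ?thesis by (simp add: algebra_simps)
    qed
  qed
  have "graph_diam V E \<le> 2 * (r * (d * L + 1)) + 4 * (d * L)"
  proof (rule graph_diam_le)
    show "finite V" unfolding V_def by (rule finite_torus_verts)
    have "n > 0" using n by (cases L) auto
    then have "card V > 0" unfolding V_def card_torus_verts by simp
    then show "V \<noteq> {}" by auto
    fix x y assume xy: "x \<in> V" "y \<in> V"
    obtain i x' where i: "i \<in> J" "x' \<in> block d L i" "(x, x') \<in> near V E (d * L)"
      using near_block[OF n tE] xy(1) unfolding V_def J_def by blast
    obtain j y' where j: "j \<in> J" "y' \<in> block d L j" "(y, y') \<in> near V E (d * L)"
      using near_block[OF n tE] xy(2) unfolding V_def J_def by blast
    obtain k where k: "(i, k) \<in> (A \<union> Id) ^^ r" "(j, k) \<in> (A \<union> Id) ^^ r" using meet[OF i(1) j(1)] by blast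
    have "L > 0" using n by (cases L) auto
    \<comment> \<open>The corner of the common block serves as meeting point of the two
      walks.\<close>
    then have z: "restrict (\<lambda>s. L * k s) {..<d} \<in> block d L k" (is "?z \<in> _")
      unfolding block_def cube_def restrict_PiE_iff by simp
    have "(x, ?z) \<in> near V E (d * L + (r * (d * L + 1) + d * L))"
      by (rule near_trans[OF i(3) reach[OF k(1) i(1,2) z]])
    moreover have "(y, ?z) \<in> near V E (d * L + (r * (d * L + 1) + d * L))"
      by (rule near_trans[OF j(3) reach[OF k(2) j(1,2) z]])
    ultimately have "(x, y) \<in> near V E ((d * L + (r * (d * L + 1) + d * L)) + (d * L + (r * (d * L + 1) + d * L)))"
      by (rule near_trans[OF _ near_sym])
    moreover have "(d * L + (r * (d * L + 1) + d * L)) + (d * L + (r * (d * L + 1) + d * L)) =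
        2 * (r * (d * L + 1)) + 4 * (d * L)" by simp
    ultimately show "(x, y) \<in> near V E (2 * (r * (d * L + 1)) + 4 * (d * L))" by (simp only:)
  qed
  then show ?thesis unfolding V_def E_def .
qed

section \<open>Asymptotics of the upper bounds\<close>

text \<open>After division by \<open>n ^ d\<close> the right-hand side tends to \<Gamma>, which
  exceeds \<open>c\<close>.\<close>

lemma eventually_degree_bound:
  fixes \<alpha> \<beta> c :: real
  assumes "c < (2 * \<beta>) ^ d - (2 * \<alpha>) ^ d"
  shows "\<forall>\<^sub>F n in sequentially. c * real n ^ d \<le> (2 * \<beta> * real n - 1) ^ d - (2 * \<alpha> * real n + 1) ^ d"
proof -
  have inv: "(\<lambda>n. 1 / real n) \<longlonglongrightarrow> 0" by real_asymp
  have "(\<lambda>n. (2 * \<beta> - 1 / real n) ^ d - (2 * \<alpha> + 1 / real n) ^ d) \<longlonglongrightarrow>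
      (2 * \<beta> - 0) ^ d - (2 * \<alpha> + 0) ^ d"
    by (intro tendsto_intros inv)
  then have "\<forall>\<^sub>F n in sequentially. c < (2 * \<beta> - 1 / real n) ^ d - (2 * \<alpha> + 1 / real n) ^ d"
    by (rule order_tendstoD) (use assms in simp)
  then show ?thesis using eventually_gt_at_top[of 0]
  proof eventually_elim
    case (elim n)
    have "c * real n ^ d \<le> ((2 * \<beta> - 1 / real n) ^ d - (2 * \<alpha> + 1 / real n) ^ d) * real n ^ d"
      using elim(1) by (intro mult_right_mono) auto
    also have "\<dots> = ((2 * \<beta> - 1 / real n) * real n) ^ d - ((2 * \<alpha> + 1 / real n) * real n) ^ d"
      unfolding power_mult_distrib by (rule left_diff_distrib)
    also have "(2 * \<beta> - 1 / real n) * real n = 2 * \<beta> * real n - 1"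
      using elim(2) by (simp add: field_simps)
    also have "(2 * \<alpha> + 1 / real n) * real n = 2 * \<alpha> * real n + 1"
      using elim(2) by (simp add: field_simps)
    finally show ?case .
  qed
qed

text \<open>In each coordinate the blocks cover all but a fraction of at most
  \<open>L n / n\<close>, which vanishes.\<close>

lemma eventually_cover_bound:
  fixes L :: "nat \<Rightarrow> nat" and \<eta> :: real
  assumes "(\<lambda>n. real (L n) / real n) \<longlonglongrightarrow> 0" "0 < \<eta>" "\<And>n. L n \<ge> 1"
  shows "\<forall>\<^sub>F n in sequentially. (1 - \<eta>) * real n ^ d \<le> real (n div L n * L n) ^ d"
proof -
  have "(\<lambda>n. (1 - real (L n) / real n) ^ d) \<longlonglongrightarrow> (1 - 0) ^ d"
    by (intro tendsto_intros assms(1))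
  then have "\<forall>\<^sub>F n in sequentially. 1 - \<eta> < (1 - real (L n) / real n) ^ d"
    by (rule order_tendstoD) (use assms in simp)
  moreover have "\<forall>\<^sub>F n in sequentially. real (L n) / real n < 1"
    using assms(1) by (rule order_tendstoD) simp
  ultimately show ?thesis using eventually_gt_at_top[of 0]
  proof eventually_elim
    case (elim n)
    have "(1 - \<eta>) * real n ^ d \<le> (1 - real (L n) / real n) ^ d * real n ^ d"
      using elim(1) by (intro mult_right_mono) auto
    also have "\<dots> = (real n - real (L n)) ^ d"
      using elim(3) by (simp add: power_mult_distrib[symmetric] field_simps)
    also have "\<dots> \<le> real (n div L n * L n) ^ d"
    proof (rule power_mono)
      have "n div L n * L n + n mod L n = n" by (rule div_mult_mod_eq)
      moreover have "n mod L n < L n" using assms(3)[of n] by (intro mod_less_divisor) simp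
      ultimately show "real n - real (L n) \<le> real (n div L n * L n)" by linarith
      show "0 \<le> real n - real (L n)" using elim(2,3) by (simp add: field_simps)
    qed
    finally show ?case .
  qed
qed

text \<open>Serves both upper bounds: \<open>C\<close> and \<open>\<sigma>\<^sub>0\<close> are fixed
  before \<sigma>, \<zeta> and the block side \<open>L\<close>. The density hypothesis asks, up to
  constants, that a block send out at least a large multiple of ln n long edges on average.\<close>

lemma prob_diam_le_tendsto_1:
  fixes \<alpha> \<beta> :: real
  assumes "d \<ge> 1" "0 < \<alpha>" "\<alpha> < \<beta>" "\<beta> < 1 / 2" and \<Gamma>: "(2 * \<beta>) ^ d - (2 * \<alpha>) ^ d > 1 / 2"
  shows "\<exists>C>0. \<exists>\<sigma>\<^sub>0>0. \<forall>\<sigma> \<zeta>. \<forall>L :: nat \<Rightarrow> nat.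
     \<sigma> > 0 \<longrightarrow> (\<forall>n. L n \<ge> 1) \<longrightarrow> (\<lambda>n. real (L n) / real n) \<longlonglongrightarrow> 0 \<longrightarrow>
     (\<forall>\<^sub>F n in sequentially. \<sigma>\<^sub>0 * ln (real n) \<le> long_edge_prob d \<sigma> \<zeta> n * real (L n) ^ d * real n ^ d) \<longrightarrow>
     (\<lambda>n. measure_pmf.prob (newman_watts d \<alpha> \<beta> \<sigma> \<zeta> n)
        {E. real (graph_diam (torus_verts d n) E) \<le> C * real (L n) * ln (real n)}) \<longlonglongrightarrow> 1"
proof -
  \<comment> \<open>With (\<Gamma> - 1/2) / 4 the degree fraction 1/2 + 3\<eta> stays strictly below
    \<Gamma>.\<close>
  define \<eta> where "\<eta> = ((2 * \<beta>) ^ d - (2 * \<alpha>) ^ d - 1 / 2) / 4"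
  have "(2 * \<beta>) ^ d \<le> 1" using assms by (intro power_le_one) auto
  moreover have "0 \<le> (2 * \<alpha>) ^ d" using assms by simp
  ultimately have \<eta>: "0 < \<eta>" "\<eta> \<le> 1" using \<Gamma> unfolding \<eta>_def by (auto simp: field_simps)
  have ln\<eta>: "ln (1 + \<eta>) > 0" using \<eta>(1) by simp
  \<comment> \<open>Makes the exponential in \<open>y\<close> at most n^(-(4d+1)): 3d powers pay for
    the lists, d for the sizes, and the last one leaves a failure probability of at most
    1/n.\<close>
  define \<sigma>\<^sub>0 where "\<sigma>\<^sub>0 = (4 * real d + 1) / \<eta>"
  \<comment> \<open>Comes from \<open>4 * d * L n * (r + 1)\<close>, where rounding \<open>r\<close>
    up and the extra 1 give the summand 2, absorbed using ln n \<ge> 1.\<close>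
  define C where "C = 4 * real d * (real d / ln (1 + \<eta>) + 2)"
  have C0: "C > 0" unfolding C_def using assms(1) ln\<eta> by (intro mult_pos_pos add_nonneg_pos) auto
  have \<sigma>0: "\<sigma>\<^sub>0 > 0" unfolding \<sigma>\<^sub>0_def using \<eta>(1) by simp
  have "(\<lambda>n. measure_pmf.prob (newman_watts d \<alpha> \<beta> \<sigma> \<zeta> n)
      {E. real (graph_diam (torus_verts d n) E) \<le> C * real (L n) * ln (real n)}) \<longlonglongrightarrow> 1"
    if \<sigma>: "\<sigma> > 0" and L: "\<And>n. L n \<ge> 1" and L0: "(\<lambda>n. real (L n) / real n) \<longlonglongrightarrow> 0"
      and dens: "\<forall>\<^sub>F n in sequentially. \<sigma>\<^sub>0 * ln (real n) \<le> long_edge_prob d \<sigma> \<zeta> n * real (L n) ^ d * real n ^ d"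
    for \<sigma> \<zeta> and L :: "nat \<Rightarrow> nat"
  proof -
    have ev1: "\<forall>\<^sub>F n in sequentially. ln (real n) \<ge> 1" by real_asymp
    have ev2: "\<forall>\<^sub>F n in sequentially. long_edge_prob d \<sigma> \<zeta> n \<le> 1"
      using eventually_long_edge_prob_le[OF assms(1) \<sigma>, of 1 \<zeta>] by simp
    have ev3: "\<forall>\<^sub>F n in sequentially. (1 / 2 + 3 * \<eta>) * real n ^ d \<le>
        (2 * \<beta> * real n - 1) ^ d - (2 * \<alpha> * real n + 1) ^ d"
      using \<eta>(1) by (intro eventually_degree_bound) (simp add: \<eta>_def field_simps)
    have ev4: "\<forall>\<^sub>F n in sequentially. 2 * \<beta> * real n + 1 \<le> real n"
    proof -
      have "1 - 2 * \<beta> > 0" using assms(4) by simp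
      then have "\<forall>\<^sub>F n in sequentially. 1 \<le> (1 - 2 * \<beta>) * real n" by real_asymp
      then show ?thesis by (rule eventually_mono) (simp add: algebra_simps)
    qed
    have "\<beta> > 0" using assms(2,3) by simp
    then have ev5: "\<forall>\<^sub>F n in sequentially. 1 \<le> 2 * \<beta> * real n" by real_asymp
    have ev6: "\<forall>\<^sub>F n in sequentially. (1 - \<eta>) * real n ^ d \<le> real (n div L n * L n) ^ d"
      by (rule eventually_cover_bound[OF L0 \<eta>(1) L])
    have ev7: "\<forall>\<^sub>F n in sequentially. real (L n) / real n < 1"
      using L0 by (rule order_tendstoD) simp
    have bound: "\<forall>\<^sub>F n in sequentially. 1 - 1 / real n \<le> measure_pmf.prob (newman_watts d \<alpha> \<beta> \<sigma> \<zeta> n)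
        {E. real (graph_diam (torus_verts d n) E) \<le> C * real (L n) * ln (real n)}"
      using dens ev1 ev2 ev3 ev4 ev5 ev6 ev7 eventually_gt_at_top[of 0]
    proof eventually_elim
      case (elim n)
      define p where "p = long_edge_prob d \<sigma> \<zeta> n"
      define P where "P = long_pairs d \<alpha> \<beta> n"
      define Q where "Q = Pi_pmf P False (\<lambda>_. bernoulli_pmf p)"
      define m where "m = n div L n"
      \<comment> \<open>Enough steps for \<open>(1 + \<eta>) ^ r\<close> to reach
        \<open>n ^ d\<close>, and hence the number of blocks.\<close>
      define r where "r = nat \<lceil>real d * ln (real n) / ln (1 + \<eta>)\<rceil>"
      define y where "y = real m ^ (3 * d) * exp (- p * real (L n) ^ d * \<eta> * real n ^ d)"
      have "real (L n) < real n" using elim(8,9) by (simp add: field_simps)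
      then have m1: "m \<ge> 1" unfolding m_def using L[of n] by (simp add: Suc_le_eq div_greater_zero_iff)
      have "m * L n + n mod L n = n" unfolding m_def by (rule div_mult_mod_eq)
      moreover have "n mod L n < L n" using L[of n] by (intro mod_less_divisor) simp
      ultimately have mL: "m * L n \<le> n" "n < m * L n + L n" by linarith+
      have mn: "real m \<le> real n" unfolding m_def by simp
      have "(4 * real d + 1) * ln (real n) = \<eta> * (\<sigma>\<^sub>0 * ln (real n))" using \<eta>(1) unfolding \<sigma>\<^sub>0_def by simp
      also have "\<dots> \<le> \<eta> * (p * real (L n) ^ d * real n ^ d)"
        using elim(1) \<eta>(1) unfolding p_def by (intro mult_left_mono) auto
      finally have "exp (- p * real (L n) ^ d * \<eta> * real n ^ d) \<le> exp (- ((4 * real d + 1) * ln (real n)))"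
        by (simp add: algebra_simps)
      also have "\<dots> = 1 / (real n ^ (3 * d) * (real n ^ d * real n))"
      proof -
        have "(4 * real d + 1) * ln (real n) = real (4 * d + 1) * ln (real n)" by simp
        then have "exp ((4 * real d + 1) * ln (real n)) = exp (ln (real n)) ^ (4 * d + 1)"
          by (simp only: exp_of_nat_mult)
        also have "\<dots> = real n ^ (3 * d + d + 1)" using elim(9) by simp
        also have "\<dots> = real n ^ (3 * d) * (real n ^ d * real n)" by (simp only: power_add power_one_right mult.assoc)
        finally show ?thesis by (simp add: exp_minus divide_inverse)
      qed
      finally have x: "exp (- p * real (L n) ^ d * \<eta> * real n ^ d) \<le> 1 / (real n ^ (3 * d) * (real n ^ d * real n))" .
      have "y \<le> real n ^ (3 * d) * (1 / (real n ^ (3 * d) * (real n ^ d * real n)))"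
        unfolding y_def using x mn by (intro mult_mono power_mono) auto
      then have y: "y \<le> 1 / (real n ^ d * real n)" using elim(9) by simp
      have "1 * 1 \<le> real n ^ d * real n" using elim(9) by (intro mult_mono one_le_power) auto
      then have "1 / (real n ^ d * real n) \<le> 1" by simp
      then have y1: "y \<le> 1" using y by linarith
      have "real m ^ d * y \<le> real n ^ d * (1 / (real n ^ d * real n))"
        using y mn by (intro mult_mono power_mono) (auto simp: y_def)
      then have my: "real m ^ d * y \<le> 1 / real n" using elim(9) by simp
      have "measure_pmf.prob Q {f. \<not> expands d m (L n) \<eta> {e \<in> P. f e}} \<le> real m ^ d * y"
        unfolding Q_def
      proof (rule prob_not_expands_le[OF mL(1) \<eta> _ _ _ _ _ y_def y1])
        show "0 \<le> p" unfolding p_def by (rule long_edge_prob_nonneg[OF \<sigma>])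
        show "p \<le> 1" using elim(3) unfolding p_def .
        show "finite P" unfolding P_def by (rule finite_long_pairs)
        show "(1 / 2 + 3 * \<eta>) * real n ^ d \<le> real (card {v \<in> torus_verts d n. {u, v} \<in> P})"
          if "u \<in> torus_verts d n" for u
          using card_long_neighbours[OF assms(1-3) elim(5) that elim(6)] elim(4) unfolding P_def by linarith
        show "(1 - \<eta>) * real n ^ d \<le> real (m * L n) ^ d" using elim(7) unfolding m_def .
      qed
      then have "1 - 1 / real n \<le> 1 - measure_pmf.prob Q {f. \<not> expands d m (L n) \<eta> {e \<in> P. f e}}"
        using my by linarith
      also have "\<dots> = measure_pmf.prob Q {f. expands d m (L n) \<eta> {e \<in> P. f e}}"
        using measure_pmf.prob_compl[of "{f. \<not> expands d m (L n) \<eta> {e \<in> P. f e}}" Q]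
        by (simp add: Compl_eq_Diff_UNIV[symmetric] Collect_neg_eq[symmetric])
      also have "\<dots> \<le> measure_pmf.prob Q
          {f. real (graph_diam (torus_verts d n) (torus_edges d n \<union> {e \<in> P. f e})) \<le> C * real (L n) * ln (real n)}"
      proof (rule measure_pmf.finite_measure_mono, intro subsetI CollectI)
        fix f assume "f \<in> {f. expands d m (L n) \<eta> {e \<in> P. f e}}"
        then have f: "expands d m (L n) \<eta> {e \<in> P. f e}" by simp
        have r_ge: "real d * ln (real n) / ln (1 + \<eta>) \<le> real r" unfolding r_def by linarith
        have "0 \<le> real d * ln (real n) / ln (1 + \<eta>)" using elim(2) ln\<eta> by simp
        then have r_le: "real r \<le> real d * ln (real n) / ln (1 + \<eta>) + 1" unfolding r_def by linarith
        have "real m ^ d \<le> real n ^ d" using mn by (intro power_mono) auto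
        also have "\<dots> = exp (real d * ln (real n))" using elim(9) by (simp add: exp_of_nat_mult)
        also have "\<dots> \<le> exp (real r * ln (1 + \<eta>))" using r_ge ln\<eta> by (simp add: field_simps)
        also have "\<dots> = (1 + \<eta>) ^ r" using \<eta>(1) by (simp add: exp_of_nat_mult)
        finally have rm: "real m ^ d \<le> (1 + \<eta>) ^ r" .
        have "graph_diam (torus_verts d n) (torus_edges d n \<union> {e \<in> P. f e}) \<le>
            2 * (r * (d * L n + 1)) + 4 * (d * L n)"
          by (rule graph_diam_le_of_expands[OF mL m1 \<eta>(1) f rm])
        \<comment> \<open>As \<open>d * L n \<ge> 1\<close>, the single edge between blocks is
          absorbed into the cost of crossing a block.\<close>
        also have "\<dots> \<le> 2 * (r * (d * L n + d * L n)) + 4 * (d * L n)"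
          using assms(1) L[of n] by (intro add_mono mult_le_mono) auto
        also have "\<dots> = 4 * d * L n * (r + 1)" by (simp add: algebra_simps)
        finally have "real (graph_diam (torus_verts d n) (torus_edges d n \<union> {e \<in> P. f e})) \<le>
            real (4 * d * L n * (r + 1))" unfolding of_nat_le_iff .
        also have "\<dots> = 4 * real d * real (L n) * (real r + 1)" by (simp add: algebra_simps)
        also have "\<dots> \<le> 4 * real d * real (L n) * ((real d / ln (1 + \<eta>) + 2) * ln (real n))"
        proof (rule mult_left_mono)
          show "real r + 1 \<le> (real d / ln (1 + \<eta>) + 2) * ln (real n)"
            using r_le elim(2) by (simp add: algebra_simps)
        qed simp
        also have "\<dots> = C * real (L n) * ln (real n)" by (simp add: C_def)
        finally show "real (graph_diam (torus_verts d n) (torus_edges d n \<union> {e \<in> P. f e})) \<le>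
            C * real (L n) * ln (real n)" .
      qed simp
      also have "\<dots> = measure_pmf.prob (newman_watts d \<alpha> \<beta> \<sigma> \<zeta> n)
          {E. real (graph_diam (torus_verts d n) E) \<le> C * real (L n) * ln (real n)}"
        unfolding Q_def P_def p_def by (rule newman_watts_prob[symmetric])
      finally show ?case .
    qed
    show ?thesis
    proof (rule tendsto_sandwich[OF bound])
      show "\<forall>\<^sub>F n in sequentially. measure_pmf.prob (newman_watts d \<alpha> \<beta> \<sigma> \<zeta> n)
          {E. real (graph_diam (torus_verts d n) E) \<le> C * real (L n) * ln (real n)} \<le> 1"
        by simp
      show "(\<lambda>n. 1 - 1 / real n) \<longlonglongrightarrow> 1" by real_asymp
    qed simp
  qed
  then show ?thesis using C0 \<sigma>0 by (intro exI[of _ C] exI[of _ \<sigma>\<^sub>0] conjI allI impI) auto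
qed

section \<open>Choice of the block side and of the constants\<close>

lemma prob_diam_le_mono_tendsto:
  assumes "(\<lambda>n. measure_pmf.prob (M n) {E. real (D n E) \<le> a n}) \<longlonglongrightarrow> 1"
    and "\<forall>\<^sub>F n in sequentially. a n \<le> b n"
  shows "(\<lambda>n. measure_pmf.prob (M n) {E. real (D n E) \<le> b n}) \<longlonglongrightarrow> 1"
proof (rule tendsto_sandwich[OF _ _ assms(1)])
  show "\<forall>\<^sub>F n in sequentially. measure_pmf.prob (M n) {E. real (D n E) \<le> a n} \<le>
      measure_pmf.prob (M n) {E. real (D n E) \<le> b n}"
    using assms(2) by eventually_elim (auto intro!: measure_pmf.finite_measure_mono)
qed auto

lemma long_edge_prob_mult:
  assumes "n > 0"
  shows "long_edge_prob d \<sigma> \<zeta> n * l * real n ^ d = \<sigma> * ln (real n) powr \<zeta> * l"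
  using assms by (simp add: long_edge_prob_def powr_minus powr_realpow field_simps)

theorem theorem1p1:
  fixes d :: nat and \<alpha> \<beta> :: real
  assumes "d \<ge> 1" and "0 < \<alpha>" and "\<alpha> < \<beta>" and "\<beta> < 1/2"
  shows
    "((2 * \<beta>) ^ d - (2 * \<alpha>) ^ d > 1/2 \<longrightarrow>
       (\<exists>\<sigma>\<^sub>0::real. \<forall>\<sigma> \<zeta>::real.
          \<sigma> > 0 \<and> (0 < \<zeta> \<and> \<zeta> < 1 \<or> \<zeta> = 0 \<and> \<sigma> \<ge> \<sigma>\<^sub>0) \<longrightarrow>
          (\<exists>C\<^sub>1>0. (\<lambda>n::nat. measure_pmf.prob (newman_watts d \<alpha> \<beta> \<sigma> \<zeta> n)
              {E. real (graph_diam (torus_verts d n) E) \<le> C\<^sub>1 * (ln (real n)) ^ 3})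
            \<longlonglongrightarrow> 1)) \<and>
       (\<exists>\<sigma>\<^sub>1::real. \<forall>\<sigma> \<zeta>::real.
          \<sigma> > 0 \<and> (\<zeta> > 1 \<or> \<zeta> = 1 \<and> \<sigma> \<ge> \<sigma>\<^sub>1) \<longrightarrow>
          (\<exists>C\<^sub>2>0. (\<lambda>n::nat. measure_pmf.prob (newman_watts d \<alpha> \<beta> \<sigma> \<zeta> n)
              {E. real (graph_diam (torus_verts d n) E) \<le> C\<^sub>2 * (ln (real n)) ^ 2})
            \<longlonglongrightarrow> 1))) \<and>
     (\<forall>\<zeta>::real. \<zeta> < 1 \<longrightarrow>
       (\<forall>\<sigma>>0. \<forall>\<nu>::real. 0 < \<nu> \<and> \<nu> < (1 - \<zeta>) / real d \<longrightarrow>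
          (\<lambda>n::nat. measure_pmf.prob (newman_watts d \<alpha> \<beta> \<sigma> \<zeta> n)
              {E. real (graph_diam (torus_verts d n) E) \<ge> ln (real n) powr \<nu>})
            \<longlonglongrightarrow> 1) \<and>
       (\<exists>\<sigma>\<^sub>2>0. \<forall>\<sigma>. 0 < \<sigma> \<and> \<sigma> \<le> \<sigma>\<^sub>2 \<longrightarrow>
          (\<lambda>n::nat. measure_pmf.prob (newman_watts d \<alpha> \<beta> \<sigma> \<zeta> n)
              {E. real (graph_diam (torus_verts d n) E) \<ge> ln (real n) powr ((1 - \<zeta>) / real d)})
            \<longlonglongrightarrow> 1))"
proof (rule conjI; intro allI impI)
  assume \<Gamma>: "(2 * \<beta>) ^ d - (2 * \<alpha>) ^ d > 1 / 2"
  from prob_diam_le_tendsto_1[OF assms \<Gamma>] obtain C \<sigma>\<^sub>0 where C: "C > 0" "\<sigma>\<^sub>0 > 0" and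
    main: "\<forall>\<sigma> \<zeta>. \<forall>L :: nat \<Rightarrow> nat.
     \<sigma> > 0 \<longrightarrow> (\<forall>n. L n \<ge> 1) \<longrightarrow> (\<lambda>n. real (L n) / real n) \<longlonglongrightarrow> 0 \<longrightarrow>
     (\<forall>\<^sub>F n in sequentially. \<sigma>\<^sub>0 * ln (real n) \<le> long_edge_prob d \<sigma> \<zeta> n * real (L n) ^ d * real n ^ d) \<longrightarrow>
     (\<lambda>n. measure_pmf.prob (newman_watts d \<alpha> \<beta> \<sigma> \<zeta> n)
        {E. real (graph_diam (torus_verts d n) E) \<le> C * real (L n) * ln (real n)}) \<longlonglongrightarrow> 1"
    by (elim exE conjE)
  have ev_ln: "\<forall>\<^sub>F n in sequentially. ln (real n) \<ge> 1" by real_asymp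
  have part1: "\<exists>C\<^sub>1>0. (\<lambda>n::nat. measure_pmf.prob (newman_watts d \<alpha> \<beta> \<sigma> \<zeta> n)
      {E. real (graph_diam (torus_verts d n) E) \<le> C\<^sub>1 * (ln (real n)) ^ 3}) \<longlonglongrightarrow> 1"
    if \<sigma>: "\<sigma> > 0" and \<zeta>: "0 < \<zeta> \<and> \<zeta> < 1 \<or> \<zeta> = 0 \<and> \<sigma> \<ge> \<sigma>\<^sub>0" for \<sigma> \<zeta>
  proof -
    \<comment> \<open>At least ln n and never 0, so \<open>L n ^ d\<close> supplies the factor ln n
      in the density condition even when \<zeta> = 0.\<close>
    define L where "L = (\<lambda>n::nat. nat \<lfloor>ln (real n)\<rfloor> + 1)"
    have L_ge: "ln (real n) \<le> real (L n)" for n unfolding L_def by linarith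
    have L_le: "real (L n) \<le> ln (real n) + 1" if "ln (real n) \<ge> 1" for n
      using that unfolding L_def by linarith
    have L0: "(\<lambda>n. real (L n) / real n) \<longlonglongrightarrow> 0"
    proof (rule tendsto_sandwich[of "\<lambda>_. 0"])
      show "\<forall>\<^sub>F n in sequentially. real (L n) / real n \<le> (ln (real n) + 1) / real n"
        using ev_ln by eventually_elim (auto intro!: divide_right_mono L_le)
      show "(\<lambda>n. (ln (real n) + 1) / real n) \<longlonglongrightarrow> 0" by real_asymp
    qed auto
    have "\<forall>\<^sub>F n in sequentially. \<sigma>\<^sub>0 \<le> \<sigma> * ln (real n) powr \<zeta>"
    proof (cases "\<zeta> = 0")
      case True
      then have "\<sigma> \<ge> \<sigma>\<^sub>0" using \<zeta> by auto
      from ev_ln show ?thesis by eventually_elim (use True \<open>\<sigma> \<ge> \<sigma>\<^sub>0\<close> in auto)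
    next
      case False
      then have "\<zeta> > 0" using \<zeta> by auto
      then show ?thesis using \<sigma> by real_asymp
    qed
    then have dens: "\<forall>\<^sub>F n in sequentially. \<sigma>\<^sub>0 * ln (real n) \<le> long_edge_prob d \<sigma> \<zeta> n * real (L n) ^ d * real n ^ d"
      using ev_ln eventually_gt_at_top[of 0]
    proof eventually_elim
      case (elim n)
      have "ln (real n) \<le> real (L n) ^ 1" using L_ge by simp
      also have "\<dots> \<le> real (L n) ^ d" using assms(1) by (intro power_increasing) (auto simp: L_def)
      finally have "\<sigma>\<^sub>0 * ln (real n) \<le> \<sigma> * ln (real n) powr \<zeta> * real (L n) ^ d"
        using elim(1,2) C(2) by (intro mult_mono) auto
      then show ?case unfolding long_edge_prob_mult[OF elim(3)] .
    qed
    have "(\<lambda>n. measure_pmf.prob (newman_watts d \<alpha> \<beta> \<sigma> \<zeta> n)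
        {E. real (graph_diam (torus_verts d n) E) \<le> C * real (L n) * ln (real n)}) \<longlonglongrightarrow> 1"
      by (rule main[rule_format, OF \<sigma> _ L0 dens]) (simp add: L_def)
    then have "(\<lambda>n. measure_pmf.prob (newman_watts d \<alpha> \<beta> \<sigma> \<zeta> n)
        {E. real (graph_diam (torus_verts d n) E) \<le> (2 * C) * (ln (real n)) ^ 3}) \<longlonglongrightarrow> 1"
    proof (rule prob_diam_le_mono_tendsto)
      \<comment> \<open>The left-hand side is already of order (ln n)^2; the cubic bound follows
        from ln n \<ge> 1.\<close>
      show "\<forall>\<^sub>F n in sequentially. C * real (L n) * ln (real n) \<le> (2 * C) * (ln (real n)) ^ 3"
        using ev_ln
      proof eventually_elim
        case (elim n)
        have "C * real (L n) * ln (real n) \<le> C * (2 * ln (real n)) * ln (real n)"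
          using elim C(1) L_le[OF elim] by (intro mult_right_mono mult_left_mono) auto
        also have "\<dots> = (2 * C) * ln (real n) ^ 2" by (simp add: power2_eq_square)
        also have "\<dots> \<le> (2 * C) * ln (real n) ^ 3"
          using elim C(1) by (intro mult_left_mono power_increasing) auto
        finally show ?case .
      qed
    qed
    then show ?thesis using C(1) by (intro exI[of _ "2 * C"]) auto
  qed
  have part2: "\<exists>C\<^sub>2>0. (\<lambda>n::nat. measure_pmf.prob (newman_watts d \<alpha> \<beta> \<sigma> \<zeta> n)
      {E. real (graph_diam (torus_verts d n) E) \<le> C\<^sub>2 * (ln (real n)) ^ 2}) \<longlonglongrightarrow> 1"
    if \<sigma>: "\<sigma> > 0" and \<zeta>: "\<zeta> > 1 \<or> \<zeta> = 1 \<and> \<sigma> \<ge> \<sigma>\<^sub>0" for \<sigma> \<zeta>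
  proof -
    have "\<forall>\<^sub>F n in sequentially. \<sigma>\<^sub>0 * ln (real n) \<le> \<sigma> * ln (real n) powr \<zeta>"
    proof (cases "\<zeta> = 1")
      case True
      then have "\<sigma> \<ge> \<sigma>\<^sub>0" using \<zeta> by auto
      from ev_ln show ?thesis
        by eventually_elim (use True \<open>\<sigma> \<ge> \<sigma>\<^sub>0\<close> in \<open>auto intro!: mult_right_mono\<close>)
    next
      case False
      then have "\<zeta> > 1" using \<zeta> by auto
      then show ?thesis using \<sigma> by real_asymp
    qed
    \<comment> \<open>Blocks of side 1 are single vertices: for \<zeta> \<ge> 1 a vertex alone has
      enough long edges. The resulting bound is linear in ln n and is then weakened to the
      square.\<close>
    then have dens: "\<forall>\<^sub>F n in sequentially. \<sigma>\<^sub>0 * ln (real n) \<le> long_edge_prob d \<sigma> \<zeta> n * real 1 ^ d * real n ^ d"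
      using eventually_gt_at_top[of 0] by eventually_elim (simp only: long_edge_prob_mult, simp)
    have "(\<lambda>n. real 1 / real n) \<longlonglongrightarrow> 0" by real_asymp
    then have "(\<lambda>n. measure_pmf.prob (newman_watts d \<alpha> \<beta> \<sigma> \<zeta> n)
        {E. real (graph_diam (torus_verts d n) E) \<le> C * real 1 * ln (real n)}) \<longlonglongrightarrow> 1"
      by (intro main[rule_format, of \<sigma> "\<lambda>_. 1", OF \<sigma> _ _ dens]) auto
    then have "(\<lambda>n. measure_pmf.prob (newman_watts d \<alpha> \<beta> \<sigma> \<zeta> n)
        {E. real (graph_diam (torus_verts d n) E) \<le> C * (ln (real n)) ^ 2}) \<longlonglongrightarrow> 1"
    proof (rule prob_diam_le_mono_tendsto)
      show "\<forall>\<^sub>F n in sequentially. C * real 1 * ln (real n) \<le> C * (ln (real n)) ^ 2"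
        using ev_ln
      proof eventually_elim
        case (elim n)
        have "ln (real n) ^ 1 \<le> ln (real n) ^ 2" using elim by (intro power_increasing) auto
        then show ?case using C(1) by simp
      qed
    qed
    then show ?thesis using C(1) by blast
  qed
  show "(\<exists>\<sigma>\<^sub>0::real. \<forall>\<sigma> \<zeta>::real.
          \<sigma> > 0 \<and> (0 < \<zeta> \<and> \<zeta> < 1 \<or> \<zeta> = 0 \<and> \<sigma> \<ge> \<sigma>\<^sub>0) \<longrightarrow>
          (\<exists>C\<^sub>1>0. (\<lambda>n::nat. measure_pmf.prob (newman_watts d \<alpha> \<beta> \<sigma> \<zeta> n)
              {E. real (graph_diam (torus_verts d n) E) \<le> C\<^sub>1 * (ln (real n)) ^ 3})
            \<longlonglongrightarrow> 1)) \<and>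
       (\<exists>\<sigma>\<^sub>1::real. \<forall>\<sigma> \<zeta>::real.
          \<sigma> > 0 \<and> (\<zeta> > 1 \<or> \<zeta> = 1 \<and> \<sigma> \<ge> \<sigma>\<^sub>1) \<longrightarrow>
          (\<exists>C\<^sub>2>0. (\<lambda>n::nat. measure_pmf.prob (newman_watts d \<alpha> \<beta> \<sigma> \<zeta> n)
              {E. real (graph_diam (torus_verts d n) E) \<le> C\<^sub>2 * (ln (real n)) ^ 2})
            \<longlonglongrightarrow> 1))"
    using part1 part2 by blast
next
  fix \<zeta> :: real
  assume \<zeta>: "\<zeta> < 1"
  have d0: "real d > 0" using assms(1) by simp
  have \<alpha>1: "\<alpha> < 1" using assms by simp
  have ev_ln: "\<forall>\<^sub>F n in sequentially. ln (real n) \<ge> 1" by real_asymp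
  show "(\<forall>\<sigma>>0. \<forall>\<nu>::real. 0 < \<nu> \<and> \<nu> < (1 - \<zeta>) / real d \<longrightarrow>
          (\<lambda>n::nat. measure_pmf.prob (newman_watts d \<alpha> \<beta> \<sigma> \<zeta> n)
              {E. real (graph_diam (torus_verts d n) E) \<ge> ln (real n) powr \<nu>})
            \<longlonglongrightarrow> 1) \<and>
       (\<exists>\<sigma>\<^sub>2>0. \<forall>\<sigma>. 0 < \<sigma> \<and> \<sigma> \<le> \<sigma>\<^sub>2 \<longrightarrow>
          (\<lambda>n::nat. measure_pmf.prob (newman_watts d \<alpha> \<beta> \<sigma> \<zeta> n)
              {E. real (graph_diam (torus_verts d n) E) \<ge> ln (real n) powr ((1 - \<zeta>) / real d)})
            \<longlonglongrightarrow> 1)"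
  proof (intro conjI allI impI)
    fix \<sigma> \<nu> :: real
    assume \<sigma>: "\<sigma> > 0" and \<nu>: "0 < \<nu> \<and> \<nu> < (1 - \<zeta>) / real d"
    define K where "K = 2 * \<sigma> * 5 ^ d"
    \<comment> \<open>The exponent of the logarithm in \<open>ev\<close>; being below 1 is
      equivalent to \<nu> < (1 - \<zeta>) / d, so ln n wins for any \<sigma>.\<close>
    define \<mu> where "\<mu> = \<nu> * real d + \<zeta>"
    have "\<mu> < 1" "K > 0" using \<nu> d0 \<sigma> by (auto simp: \<mu>_def K_def field_simps)
    then have "\<forall>\<^sub>F n in sequentially. K * ln (real n) powr \<mu> \<le> ln (real n) / 4" by real_asymp
    then show "(\<lambda>n::nat. measure_pmf.prob (newman_watts d \<alpha> \<beta> \<sigma> \<zeta> n)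
              {E. real (graph_diam (torus_verts d n) E) \<ge> ln (real n) powr \<nu>}) \<longlonglongrightarrow> 1"
      using assms \<alpha>1 \<sigma> \<nu> by (intro prob_diam_ge_tendsto_1) (auto simp: K_def \<mu>_def)
  next
    show "\<exists>\<sigma>\<^sub>2>0. \<forall>\<sigma>. 0 < \<sigma> \<and> \<sigma> \<le> \<sigma>\<^sub>2 \<longrightarrow>
          (\<lambda>n::nat. measure_pmf.prob (newman_watts d \<alpha> \<beta> \<sigma> \<zeta> n)
              {E. real (graph_diam (torus_verts d n) E) \<ge> ln (real n) powr ((1 - \<zeta>) / real d)})
            \<longlonglongrightarrow> 1"
    \<comment> \<open>At the critical \<nu> both sides of \<open>ev\<close> are linear in ln n, so
      the constants decide: 2 \<sigma> 5^d \<le> 1/4.\<close>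
    proof (intro exI[of _ "1 / (8 * 5 ^ d)"] conjI allI impI)
      show "(0::real) < 1 / (8 * 5 ^ d)" by simp
      fix \<sigma> :: real
      assume \<sigma>: "0 < \<sigma> \<and> \<sigma> \<le> 1 / (8 * 5 ^ d)"
      have exponent: "(1 - \<zeta>) / real d * real d + \<zeta> = 1" using d0 by simp
      have "\<sigma> * 5 ^ d \<le> 1 / (8 * 5 ^ d) * 5 ^ d" using \<sigma> by (intro mult_right_mono) auto
      then have K: "2 * \<sigma> * 5 ^ d \<le> 1 / 4" by simp
      have "\<forall>\<^sub>F n in sequentially.
          2 * \<sigma> * 5 ^ d * ln (real n) powr ((1 - \<zeta>) / real d * real d + \<zeta>) \<le> ln (real n) / 4"
        using ev_ln
      proof eventually_elim
        case (elim n)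
        then show ?case unfolding exponent using mult_right_mono[OF K, of "ln (real n)"] by simp
      qed
      then show "(\<lambda>n::nat. measure_pmf.prob (newman_watts d \<alpha> \<beta> \<sigma> \<zeta> n)
              {E. real (graph_diam (torus_verts d n) E) \<ge> ln (real n) powr ((1 - \<zeta>) / real d)}) \<longlonglongrightarrow> 1"
        using assms \<alpha>1 \<sigma> \<zeta> d0 by (intro prob_diam_ge_tendsto_1) auto
    qed
  qed
qed

end
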